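(* Let $\tau > \omega$ be a cardinal and $|T| = \tau$. For a closed set $M \subset I^{T}$ the following conditions are equivalent: (1) $M$ is a $Z_{\tau}$-set in $I^{T}$; (2) if $F\subset M$ is a non-empty closed subset, then $\psi(F,I^{T}) =\tau$; (3) $T$ can be represented as an increasing union $T = \bigcup\{ T_{\alpha} \colon \alpha < \tau \}$ of its subsets so that (a) $|T_{0}| = \omega$; (b) $|T_{\alpha +1} \setminus T_{\alpha}| = \omega$ for each $\alpha<\tau$; (c) $T_{\alpha} = \bigcup\{ T_{\beta} \colon \beta < \alpha \}$ for each limit ordinal $\alpha < \tau$; (d) for each $\alpha<\tau$, $\pi_{T_{\alpha +1}}(M)$ is a fibered $Z$-set in $I^{T_{\alpha +1}}$ with respect to the projection $\pi_{T_{\alpha}}^{T_{\alpha +1}} \colon I^{T_{\alpha +1}} \to I^{T_{\alpha}}$.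
   Context: $I=[0,1]$; for $R\subseteq S\subseteq T$, $\pi_S\colon I^T\to I^S$ and $\pi^S_R\colon I^S\to I^R$ are the natural projections. $\psi(F,X)$ is the pseudocharacter of $F$ in $X$, i.e. the least cardinality of a family of open subsets of $X$ whose intersection is $F$. For a Tychonov space $Y$ let $\operatorname{cov}(Y)$ be the collection of all countable covers of $Y$ by functionally open (cozero) sets. Maps $f,g\colon X\to Y$ are ${\mathcal U}$-close if for each $x\in X$ some $U\in{\mathcal U}$ contains both $f(x)$ and $g(x)$. For an infinite cardinal $\tau$, $C_\tau(X,Y)$ is the set of continuous maps $X\to Y$ with the topology in which $G$ is open iff for each $h\in G$ there is a family $\{{\mathcal U}_t\colon t\in T'\}\subseteq\operatorname{cov}(Y)$ with $|T'|<\tau$ such that every $g$ that is ${\mathcal U}_t$-close to $h$ for all $t\in T'$ belongs to $G$. A closed subset $A\subset X$ is a $Z_\tau$-set in $X$ if $\{f\in C_\tau(X,X)\colon f(X)\cap A=\emptyset\}$ is dense in $C_\tau(X,X)$. Given a map $\pi\colon X\to Y$ of compact spaces, a closed subset $A\subset X$ is a fibered $Z$-set in $X$ with respect to $\pi$ if $\{f\in C^\pi(X,X)\colon f(X)\cap A=\emptyset\}$ is dense in $C^\pi(X,X)=\{f\in C_\omega(X,X)\colon \pi\circ f=\pi\}$ (for compact $X$ the topology of $C_\omega(X,X)$ is that of uniform convergence). *)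

theory Defs
  imports "HOL-Analysis.Analysis"
begin

unbundle cardinal_syntax

(* Cardinals are Card_order relations in the sense of the cardinals library of Main; omega is natLeq,
   and the ordinals below a cardinal r are the elements of "Field r", ordered by r. *)

section \<open>Tychonov cubes\<close>

(* Points of the cube are the functions S -> [0,1], extended by "undefined" outside S;
   the projection onto a subset R of S is "\<lambda>x. restrict x R". *)

definition cube :: "'t set \<Rightarrow> ('t \<Rightarrow> real) topology" where
  "cube S = product_topology (\<lambda>_. top_of_set {0..1}) S"

section \<open>Pseudocharacter\<close>

(* Families of open sets are required to be nonempty, so that the intersection
   is a subset of the space. *)

definition pseudo_base :: "'a topology \<Rightarrow> 'a set \<Rightarrow> 'a set set \<Rightarrow> bool" where
  "pseudo_base X F \<U> \<longleftrightarrow> \<U> \<noteq> {} \<and> (\<forall>U\<in>\<U>. openin X U) \<and> \<Inter>\<U> = F"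

definition pseudocharacter :: "'a set \<Rightarrow> 'a topology \<Rightarrow> 'a set rel" where
  "pseudocharacter F X =
     |SOME \<U>. pseudo_base X F \<U> \<and> (\<forall>\<V>. pseudo_base X F \<V> \<longrightarrow> |\<U>| \<le>o |\<V>| )|"

lemma pseudocharacter_least:
  assumes "pseudo_base X F \<W>"
  shows "\<exists>\<U>. pseudo_base X F \<U> \<and> pseudocharacter F X = |\<U>|"
    and "pseudo_base X F \<V> \<Longrightarrow> pseudocharacter F X \<le>o |\<V>|"
proof -
  let ?P = "\<lambda>\<U>. pseudo_base X F \<U> \<and> (\<forall>\<V>. pseudo_base X F \<V> \<longrightarrow> |\<U>| \<le>o |\<V>| )"
  have "\<exists>r \<in> card_of ` Collect (pseudo_base X F). \<forall>r' \<in> card_of ` Collect (pseudo_base X F). r \<le>o r'"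
    by (rule exists_minim_Card_order) (use assms card_of_Card_order in blast)+
  then have "\<exists>\<U>. ?P \<U>" by blast
  then have "?P (SOME \<U>. ?P \<U>)" by (rule someI_ex)
  then show "\<exists>\<U>. pseudo_base X F \<U> \<and> pseudocharacter F X = |\<U>|"
    and "pseudo_base X F \<V> \<Longrightarrow> pseudocharacter F X \<le>o |\<V>|"
    unfolding pseudocharacter_def by blast+
qed

section \<open>The function spaces and Z-sets\<close>

definition functionally_open :: "'a topology \<Rightarrow> 'a set \<Rightarrow> bool" where
  "functionally_open Y U \<longleftrightarrow>
     (\<exists>f. continuous_map Y euclideanreal f \<and> U = {y \<in> topspace Y. f y \<noteq> 0})"

definition cov :: "'a topology \<Rightarrow> 'a set set set" where
  "cov Y = {\<U>. countable \<U> \<and> (\<forall>U\<in>\<U>. functionally_open Y U) \<and> \<Union>\<U> = topspace Y}"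

definition close_maps :: "'a topology \<Rightarrow> 'b set set \<Rightarrow> ('a \<Rightarrow> 'b) \<Rightarrow> ('a \<Rightarrow> 'b) \<Rightarrow> bool" where
  "close_maps X \<U> f g \<longleftrightarrow> (\<forall>x\<in>topspace X. \<exists>U\<in>\<U>. f x \<in> U \<and> g x \<in> U)"

(* Extensionality makes each continuous map correspond to exactly one HOL function. *)

definition cmaps :: "'a topology \<Rightarrow> 'b topology \<Rightarrow> ('a \<Rightarrow> 'b) set" where
  "cmaps X Y = {f \<in> extensional (topspace X). continuous_map X Y f}"

definition C_open :: "'k rel \<Rightarrow> 'a topology \<Rightarrow> 'b topology \<Rightarrow> ('a \<Rightarrow> 'b) set \<Rightarrow> bool" where
  "C_open r X Y G \<longleftrightarrow> G \<subseteq> cmaps X Y \<and>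
     (\<forall>h\<in>G. \<exists>\<C>\<subseteq>cov Y. |\<C>| <o r \<and>
        (\<forall>g\<in>cmaps X Y. (\<forall>\<U>\<in>\<C>. close_maps X \<U> g h) \<longrightarrow> g \<in> G))"

(* For infinite r the sets in C_open form a topology, see openin_C_space below. *)

definition C_space :: "'k rel \<Rightarrow> 'a topology \<Rightarrow> 'b topology \<Rightarrow> ('a \<Rightarrow> 'b) topology" where
  "C_space r X Y = topology (C_open r X Y)"

lemma openin_C_space:
  assumes "Cinfinite r"
  shows "openin (C_space r X Y) = C_open r X Y"
proof -
  have "C_open r X Y (G \<inter> H)" if G: "C_open r X Y G" and H: "C_open r X Y H" for G H
    unfolding C_open_def
  proof (intro conjI ballI)
    show "G \<inter> H \<subseteq> cmaps X Y" using G by (auto simp: C_open_def)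
    fix h assume h: "h \<in> G \<inter> H"
    obtain \<C> where C: "\<C> \<subseteq> cov Y" "|\<C>| <o r"
      "\<forall>g\<in>cmaps X Y. (\<forall>\<U>\<in>\<C>. close_maps X \<U> g h) \<longrightarrow> g \<in> G"
      using G h unfolding C_open_def by blast
    obtain \<D> where D: "\<D> \<subseteq> cov Y" "|\<D>| <o r"
      "\<forall>g\<in>cmaps X Y. (\<forall>\<U>\<in>\<D>. close_maps X \<U> g h) \<longrightarrow> g \<in> H"
      using H h unfolding C_open_def by blast
    have "|\<C> \<union> \<D>| <o r" by (rule Un_Cinfinite_bound_strict[OF C(2) D(2) assms])
    with C D show "\<exists>\<E>\<subseteq>cov Y. |\<E>| <o r \<and>
        (\<forall>g\<in>cmaps X Y. (\<forall>\<U>\<in>\<E>. close_maps X \<U> g h) \<longrightarrow> g \<in> G \<inter> H)"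
      by (intro exI[of _ "\<C> \<union> \<D>"]) auto
  qed
  moreover have "C_open r X Y (\<Union>\<G>)" if G: "\<forall>G\<in>\<G>. C_open r X Y G" for \<G>
    unfolding C_open_def
  proof (intro conjI ballI)
    show "\<Union>\<G> \<subseteq> cmaps X Y" using G by (auto simp: C_open_def)
    fix h assume "h \<in> \<Union>\<G>"
    then obtain G0 where "h \<in> G0" "G0 \<in> \<G>" by blast
    moreover from this have "C_open r X Y G0" using G by blast
    ultimately obtain \<C> where "\<C> \<subseteq> cov Y" "|\<C>| <o r"
      "\<forall>g\<in>cmaps X Y. (\<forall>\<U>\<in>\<C>. close_maps X \<U> g h) \<longrightarrow> g \<in> G0"
      unfolding C_open_def by blast
    with \<open>G0 \<in> \<G>\<close> show "\<exists>\<C>\<subseteq>cov Y. |\<C>| <o r \<and>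
        (\<forall>g\<in>cmaps X Y. (\<forall>\<U>\<in>\<C>. close_maps X \<U> g h) \<longrightarrow> g \<in> \<Union>\<G>)"
      by blast
  qed
  ultimately have "istopology (C_open r X Y)" unfolding istopology_def by iprover
  then show ?thesis unfolding C_space_def by (rule topology_inverse')
qed

lemma topspace_C_space:
  assumes "Cinfinite r"
  shows "topspace (C_space r X Y) = cmaps X Y"
proof -
  have "C_open r X Y (cmaps X Y)"
    unfolding C_open_def
  proof (intro conjI ballI subset_refl)
    fix h :: "'b \<Rightarrow> 'c"
    have "|{} :: 'c set set set| <o r" by (rule Cinfinite_gt_empty[OF assms])
    then show "\<exists>\<C>\<subseteq>cov Y. |\<C>| <o r \<and>
        (\<forall>g\<in>cmaps X Y. (\<forall>\<U>\<in>\<C>. close_maps X \<U> g h) \<longrightarrow> g \<in> cmaps X Y)"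
      by blast
  qed
  then have "cmaps X Y \<subseteq> topspace (C_space r X Y)"
    using openin_subset[of "C_space r X Y"] by (simp add: openin_C_space[OF assms])
  moreover have "C_open r X Y (topspace (C_space r X Y))"
    using openin_topspace[of "C_space r X Y"] by (simp add: openin_C_space[OF assms])
  ultimately show ?thesis by (auto simp: C_open_def)
qed

definition dense_subset :: "'a topology \<Rightarrow> 'a set \<Rightarrow> bool" where
  "dense_subset X D \<longleftrightarrow> D \<subseteq> topspace X \<and> X closure_of D = topspace X"

definition Z_set :: "'k rel \<Rightarrow> 'a topology \<Rightarrow> 'a set \<Rightarrow> bool" where
  "Z_set r X A \<longleftrightarrow> closedin X A \<and>
     dense_subset (C_space r X X) {f \<in> cmaps X X. f ` topspace X \<inter> A = {}}"

definition fibered_cmaps :: "'a topology \<Rightarrow> ('a \<Rightarrow> 'b) \<Rightarrow> ('a \<Rightarrow> 'a) set" where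
  "fibered_cmaps X p = {f \<in> cmaps X X. \<forall>x\<in>topspace X. p (f x) = p x}"

(* To be used for a continuous map p from X to a compact space, X compact; the codomain
   does not enter otherwise. *)

definition fibered_Z_set :: "'a topology \<Rightarrow> ('a \<Rightarrow> 'b) \<Rightarrow> 'a set \<Rightarrow> bool" where
  "fibered_Z_set X p A \<longleftrightarrow> closedin X A \<and>
     dense_subset (subtopology (C_space natLeq X X) (fibered_cmaps X p))
       {f \<in> fibered_cmaps X p. f ` topspace X \<inter> A = {}}"

section \<open>Ordinals below a cardinal\<close>

definition ord_zero :: "'k rel \<Rightarrow> 'k" where
  "ord_zero r = wo_rel.minim r (Field r)"

(* "wo_rel.suc r A" is the least strict upper bound of A. *)

definition ord_succ :: "'k rel \<Rightarrow> 'k \<Rightarrow> 'k" where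
  "ord_succ r a = wo_rel.suc r {a}"

definition ord_limit :: "'k rel \<Rightarrow> 'k \<Rightarrow> bool" where
  "ord_limit r a \<longleftrightarrow> a \<in> Field r \<and> a \<noteq> ord_zero r \<and> (\<forall>b\<in>Field r. a \<noteq> ord_succ r b)"

end

theory Submission
  imports Defs "HOL-Library.Countable_Set_Type"
begin

text \<open>
  Everything passes through one combinatorial property of \<open>M\<close>: outside every set of fewer than
  \<open>\<tau>\<close> coordinates there is a finite set \<open>E\<close> of coordinates such that the projection of \<open>M\<close> to the
  face \<open>I\<^sup>E\<close> is not onto (\<open>widely_omitting\<close>).  If a map is changed on the coordinates in
  \<open>E\<close> only, by making it constant there with a value outside the projection of \<open>M\<close>, then its
  image leaves \<open>M\<close>, and the map remains the same in all coordinates outside \<open>E\<close>.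

  On the other side stands the property that no fibre of a projection \<open>I\<^sup>T \<rightarrow> I\<^sup>S\<close> with
  \<open>|S| < \<tau>\<close> lies in \<open>M\<close> (\<open>fibre_free\<close>).  It is a restatement of the condition on
  pseudocharacters, because a closed set with pseudocharacter below \<open>\<tau>\<close> contains such a fibre
  through each of its points, and such a fibre has pseudocharacter below \<open>\<tau>\<close>.  A \<open>Z\<^sub>\<tau>\<close>-set
  has it, because being equal to the identity in fewer than \<open>\<tau>\<close> coordinates is an open condition
  in \<open>C\<^sub>\<tau>\<close>, so that some map moves the points of a fibre within the fibre and off \<open>M\<close>.  The
  existence of a filtration \<open>T\<^sub>\<alpha>\<close> implies it, because fewer than \<open>\<tau>\<close> coordinates miss one of
  the \<open>\<tau>\<close> disjoint layers \<open>T\<^sub>\<alpha>\<^sub>+\<^sub>1 - T\<^sub>\<alpha>\<close>: a fibre over them inside \<open>M\<close> would put a whole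
  fibre of the projection that forgets this layer into the projection of \<open>M\<close>, which a fibered
  Z-set cannot contain.

  The heart is \<open>fibre_free_imp_widely_omitting\<close>.  For \<open>|S| < \<tau>\<close> take a maximal system of
  compatible finite partial points \<open>x|E\<close> on \<open>T - S\<close>, each with its own rational box \<open>c\<close> in the
  coordinates \<open>S\<close> over which it avoids \<open>M\<close>.  There are fewer than \<open>\<tau>\<close> rational boxes, so the
  union \<open>z\<close> of the partial points lives on a set \<open>D\<close> of fewer than \<open>\<tau>\<close> coordinates.  A point
  of \<open>M\<close> agreeing with \<open>z\<close> on \<open>D\<close> would have, by the absence of fibres over \<open>S \<union> D\<close>, a
  partner outside \<open>M\<close> with the same coordinates in \<open>S \<union> D\<close>, and a rational box around the
  partner would enlarge the system.  Hence no point of \<open>M\<close> agrees with \<open>z\<close> on \<open>D\<close>, and by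
  compactness finitely many coordinates of \<open>D\<close> suffice.

  Omitted points make \<open>M\<close> a \<open>Z\<^sub>\<tau>\<close>-set by changing maps as described, since each countable cozero cover of a
  cube is controlled by finitely many coordinates (\<open>cov_finite_support\<close>).  They yield a filtration because there
  are then \<open>\<tau>\<close> disjoint sets \<open>E\<close>, which can be distributed so that every layer
  \<open>T\<^sub>\<alpha>\<^sub>+\<^sub>1 - T\<^sub>\<alpha>\<close> receives infinitely many: some set \<open>E\<close> in the layer then avoids the
  finitely many coordinates that control a given approximation.
\<close>

section \<open>Cardinal bounds and maximal families\<close>

lemma finite_ordLess_Cinfinite: "Cinfinite r \<Longrightarrow> finite X \<Longrightarrow> |X| <o r"
  by (rule Cfinite_ordLess_Cinfinite) (simp_all add: cfinite_def Field_card_of card_of_card_order_on)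

lemma Cinfinite_card_of: "infinite X \<Longrightarrow> Cinfinite |X|"
  by (simp add: cinfinite_def Field_card_of card_of_card_order_on)

lemma Cinfinite_if_uncountable: "Card_order r \<Longrightarrow> natLeq <o r \<Longrightarrow> Cinfinite r"
  using cinfinite_mono natLeq_cinfinite ordLess_imp_ordLeq by blast

lemma countable_infinite_natLeq: "countable X \<Longrightarrow> infinite X \<Longrightarrow> |X| =o natLeq"
  using infinite_iff_natLeq_ordLeq[of X] by (simp add: ordIso_iff_ordLeq countable_card_le_natLeq)

lemma Fpow_infinite_bound:
  assumes r: "Cinfinite r" and X: "|X| \<le>o r"
  shows "|Fpow X| \<le>o r"
proof -
  let ?C = "\<lambda>n. {c \<in> Fpow X. card c \<le> n}"
  have "|?C n| \<le>o r" for n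
  proof (induction n)
    case 0
    have "?C 0 \<subseteq> {{}}" by (auto simp: Fpow_def)
    then have "finite (?C 0)" by (rule finite_subset) simp
    then show ?case
      using finite_ordLess_Cinfinite[OF r] ordLess_imp_ordLeq by blast
  next
    case (Suc n)
    have "?C (Suc n) \<subseteq> {{}} \<union> (\<Union>x\<in>X. insert x ` ?C n)"
    proof
      fix c assume c: "c \<in> ?C (Suc n)"
      show "c \<in> {{}} \<union> (\<Union>x\<in>X. insert x ` ?C n)"
      proof (cases "c = {}")
        case False
        then obtain x where x: "x \<in> c" by blast
        with c have "c - {x} \<in> ?C n" "c = insert x (c - {x})" "x \<in> X"
          by (auto simp: Fpow_def)
        then show ?thesis by blast
      qed simp
    qed
    moreover have "|{{}} \<union> (\<Union>x\<in>X. insert x ` ?C n)| \<le>o r"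
    proof (rule Un_Cinfinite_bound[OF _ _ r])
      show "|{{}}| \<le>o r"
        by (rule ordLess_imp_ordLeq[OF finite_ordLess_Cinfinite[OF r]]) simp
      show "|\<Union>x\<in>X. insert x ` ?C n| \<le>o r"
        using X Suc.IH r by (intro UNION_Cinfinite_bound ballI ordLeq_transitive[OF card_of_image]) auto
    qed
    ultimately show ?case using ordLeq_transitive[OF card_of_mono1] by blast
  qed
  then have "|\<Union>n. ?C n| \<le>o r"
    by (intro UNION_Cinfinite_bound r ballI ordIso_ordLeq_trans[OF card_of_nat natLeq_ordLeq_cinfinite[OF r]])
  moreover have "Fpow X = (\<Union>n. ?C n)" by auto
  ultimately show ?thesis by simp
qed

lemma Fpow_ordLess:
  assumes r: "Cinfinite r" and X: "|X| <o r"
  shows "|Fpow X| <o r"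
proof (cases "finite X")
  case True
  then have "finite (Fpow X)" by (simp add: Fpow_Pow_finite)
  then show ?thesis by (rule finite_ordLess_Cinfinite[OF r])
next
  case False
  then have "Cinfinite |X|" by (rule Cinfinite_card_of)
  then have "|Fpow X| \<le>o |X|" by (rule Fpow_infinite_bound) (rule card_of_mono1[OF subset_refl])
  then show ?thesis using X by (rule ordLeq_ordLess_trans)
qed

text \<open>
  The bound is strict for singular and for countable \<open>r\<close> as well: a union of infinitely many finite
  sets is no larger than its index set.
\<close>

lemma UN_finite_ordLess:
  assumes r: "Cinfinite r" and I: "|I| <o r" and fin: "\<And>i. i \<in> I \<Longrightarrow> finite (F i)"
  shows "|\<Union>i\<in>I. F i| <o r"
proof (cases "finite I")
  case True
  then show ?thesis using fin by (intro finite_ordLess_Cinfinite[OF r]) auto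
next
  case False
  then have I_inf: "Cinfinite |I|" by (rule Cinfinite_card_of)
  have "|\<Union>i\<in>I. F i| \<le>o |I|"
    by (intro card_of_UNION_ordLeq_infinite[OF False] card_of_mono1 subset_refl ballI
        ordLess_imp_ordLeq[OF finite_ordLess_Cinfinite[OF I_inf]] fin)
  then show ?thesis using I by (rule ordLeq_ordLess_trans)
qed

lemma Times_countable_ordLess:
  assumes r: "Card_order r" "natLeq <o r" and X: "|X| <o r" and B: "countable B"
  shows "|X \<times> B| <o r"
proof -
  have B': "|B| \<le>o natLeq" using B by (simp add: countable_card_le_natLeq)
  show ?thesis
  proof (cases "finite X")
    case True
    have "|X| \<le>o natLeq"
      by (rule ordLess_imp_ordLeq[OF finite_ordLess_Cinfinite[OF natLeq_Cinfinite True]])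
    with B' have "|X \<times> B| \<le>o natLeq"
      by (intro card_of_Times_ordLeq_infinite_Field natLeq_Card_order) (simp_all add: Field_natLeq)
    then show ?thesis using r(2) by (rule ordLeq_ordLess_trans)
  next
    case False
    have "natLeq \<le>o |X|" using False infinite_iff_natLeq_ordLeq[of X] by blast
    with B' have "|B| \<le>o |X|" by (rule ordLeq_transitive)
    then have "|X \<times> B| \<le>o |X|"
      by (intro card_of_Times_ordLeq_infinite_Field card_of_mono1 card_of_Card_order subset_refl)
        (simp_all add: Field_card_of False)
    then show ?thesis using X by (rule ordLeq_ordLess_trans)
  qed
qed

lemma card_of_choice_le:
  assumes "\<And>a. a \<in> I \<Longrightarrow> D a \<inter> S \<noteq> {}" "\<And>a b. a \<in> I \<Longrightarrow> b \<in> I \<Longrightarrow> a \<noteq> b \<Longrightarrow> D a \<inter> D b = {}"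
  shows "|I| \<le>o |S|"
proof -
  have "\<forall>a\<in>I. \<exists>s. s \<in> D a \<inter> S" using assms(1) by blast
  then obtain f where f: "\<forall>a\<in>I. f a \<in> D a \<inter> S" by (rule bchoice[THEN exE])
  have "inj_on f I"
  proof (rule inj_onI, rule ccontr)
    fix a b assume "a \<in> I" "b \<in> I" "f a = f b" "a \<noteq> b"
    then show False using f assms(2)[of a b] by (metis IntD1 disjoint_iff)
  qed
  moreover have "f ` I \<subseteq> S" using f by blast
  ultimately show ?thesis by (intro card_of_ordLeq[THEN iffD1] exI[of _ f] conjI)
qed

lemma infinite_UN_disjoint:
  assumes "\<And>n :: nat. f n \<noteq> {}" "\<And>m n. m \<noteq> n \<Longrightarrow> f m \<inter> f n = {}"
  shows "infinite (\<Union>n. f n)"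
proof
  assume fin: "finite (\<Union>n. f n)"
  have "|UNIV :: nat set| \<le>o |\<Union>n. f n|" 
    by (rule card_of_choice_le[of _ f]) (use assms in blast)+
  then have "finite (UNIV :: nat set)" using fin card_of_ordLeq_finite by blast
  then show False by simp
qed

text \<open>
  Zorn's lemma in the form in which it is applied here: twice, to compatible partial points and to
  disjoint sets of coordinates.
\<close>

lemma maximal_pairwise:
  obtains A where "A \<subseteq> P" "pairwise R A"
    "\<And>p. p \<in> P \<Longrightarrow> (\<And>a. a \<in> A \<Longrightarrow> R a p \<and> R p a) \<Longrightarrow> p \<in> A"
proof -
  have "\<exists>A\<in>{A. A \<subseteq> P \<and> pairwise R A}. \<forall>B\<in>{A. A \<subseteq> P \<and> pairwise R A}. A \<subseteq> B \<longrightarrow> B = A"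
  proof (rule subset_Zorn')
    fix C assume C: "subset.chain {A. A \<subseteq> P \<and> pairwise R A} C"
    then have "pairwise R (\<Union>C)"
      by (intro pairwise_chain_Union) (auto simp: subset_chain_def chain_subset_def)
    then show "\<Union>C \<in> {A. A \<subseteq> P \<and> pairwise R A}"
      using C by (auto simp: subset.chain_def)
  qed
  then obtain A where A: "A \<subseteq> P" "pairwise R A"
    and mx: "\<forall>B\<in>{A. A \<subseteq> P \<and> pairwise R A}. A \<subseteq> B \<longrightarrow> B = A"
    by (elim bexE CollectE conjE)
  show thesis
  proof (rule that[OF A])
    fix p assume p: "p \<in> P" "\<And>a. a \<in> A \<Longrightarrow> R a p \<and> R p a"
    have "insert p A \<in> {A. A \<subseteq> P \<and> pairwise R A}"
      using p A by (simp add: pairwise_insert)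
    with mx have "insert p A = A" by (metis subset_insertI)
    then show "p \<in> A" by blast
  qed
qed

section \<open>Cubes\<close>

lemma topspace_cube: "topspace (cube S) = S \<rightarrow>\<^sub>E {0..1}"
  by (simp add: cube_def)

lemma compact_space_cube: "compact_space (cube S)"
  by (simp add: cube_def compact_space_product_topology compact_space_subtopology)

lemma Hausdorff_space_cube: "Hausdorff_space (cube S)"
  by (simp add: cube_def Hausdorff_space_product_topology Hausdorff_space_subtopology)

lemma continuous_map_coordinate:
  "t \<in> S \<Longrightarrow> continuous_map (cube S) euclideanreal (\<lambda>x. x t)"
  unfolding cube_def
  by (metis continuous_map_into_fulltopology continuous_map_product_projection)

lemma continuous_map_into_cube:
  "continuous_map X (cube S) f \<longleftrightarrow>
    (\<forall>x\<in>topspace X. f x \<in> topspace (cube S)) \<and> (\<forall>t\<in>S. continuous_map X euclideanreal (\<lambda>x. f x t))"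
  unfolding cube_def continuous_map_componentwise
  by (auto simp: continuous_map_in_subtopology PiE_iff Pi_iff)

lemma continuous_map_restrict_cube:
  "S \<subseteq> T \<Longrightarrow> continuous_map (cube T) (cube S) (\<lambda>x. restrict x S)"
  unfolding continuous_map_into_cube
  by (auto simp: topspace_cube continuous_map_coordinate subset_eq)

text \<open>
  Finite codes for closed boxes.  Codes over fewer than \<open>\<tau>\<close> coordinates are fewer than
  \<open>\<tau>\<close>, and a code splits into the constraints inside and outside a given set of coordinates.
\<close>

definition rational_box :: "('t \<times> rat \<times> rat) set \<Rightarrow> ('t \<Rightarrow> real) set" where
  "rational_box c = {x. \<forall>(s, q, r)\<in>c. real_of_rat q \<le> x s \<and> x s \<le> real_of_rat r}"

lemma rational_boxD:
  "x \<in> rational_box c \<Longrightarrow> (s, q, r) \<in> c \<Longrightarrow> real_of_rat q \<le> x s \<and> x s \<le> real_of_rat r"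
  by (auto simp: rational_box_def)

lemma closedin_rational_box:
  assumes "c \<subseteq> S \<times> UNIV"
  shows "closedin (cube S) (topspace (cube S) \<inter> rational_box c)"
proof -
  have "closedin (cube S) {x \<in> topspace (cube S). x s \<in> {real_of_rat q..real_of_rat r}}"
    if "(s, q, r) \<in> c" for s q r
    using that assms by (intro closedin_continuous_map_preimage[OF continuous_map_coordinate]) auto
  moreover have "topspace (cube S) \<inter> rational_box c =
      topspace (cube S) \<inter> \<Inter>((\<lambda>(s, q, r). {x \<in> topspace (cube S). x s \<in> {real_of_rat q..real_of_rat r}}) ` c)"
    by (auto simp: rational_box_def)
  ultimately show ?thesis
    by (cases "c = {}") (auto intro!: closedin_Int closedin_Inter)
qed

lemma rational_box_neighbourhood:
  assumes "openin (cube W) U" "x \<in> U"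
  obtains c where "finite c" "c \<subseteq> W \<times> UNIV" "x \<in> rational_box c" "topspace (cube W) \<inter> rational_box c \<subseteq> U"
proof -
  obtain V where V: "finite {i \<in> W. V i \<noteq> {0..1}}" "\<And>i. i \<in> W \<Longrightarrow> openin (top_of_set {0..1::real}) (V i)"
    "x \<in> Pi\<^sub>E W V" "Pi\<^sub>E W V \<subseteq> U"
    using assms unfolding cube_def openin_product_topology_alt by force
  let ?E = "{i \<in> W. V i \<noteq> {0..1}}"
  have "\<exists>q r. real_of_rat q \<le> x i \<and> x i \<le> real_of_rat r \<and> {real_of_rat q..real_of_rat r} \<inter> {0..1} \<subseteq> V i"
    if "i \<in> W" for i
  proof -
    have "openin (top_of_set {0..1}) (V i)" by (rule V(2)[OF that])
    then obtain O' where O': "open O'" "V i = {0..1} \<inter> O'"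
      unfolding openin_open by blast
    have "x i \<in> O'" using V(3) that O'(2) by (auto simp: PiE_iff)
    then obtain e where e: "e > 0" "ball (x i) e \<subseteq> O'" using O'(1) openE by blast
    obtain q where q: "x i - e < real_of_rat q" "real_of_rat q < x i"
      using of_rat_dense[of "x i - e" "x i"] e by auto
    obtain r where r: "x i < real_of_rat r" "real_of_rat r < x i + e"
      using of_rat_dense[of "x i" "x i + e"] e by auto
    have "{real_of_rat q..real_of_rat r} \<subseteq> ball (x i) e"
      using q r by (auto simp: dist_real_def)
    then show ?thesis using q r e O' by (intro exI[of _ q] exI[of _ r]) auto
  qed
  then obtain q r where qr: "\<And>i. i \<in> W \<Longrightarrow> real_of_rat (q i) \<le> x i \<and> x i \<le> real_of_rat (r i) \<and>
      {real_of_rat (q i)..real_of_rat (r i)} \<inter> {0..1} \<subseteq> V i"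
    by metis
  show thesis
  proof (rule that[of "(\<lambda>i. (i, q i, r i)) ` ?E"])
    show "x \<in> rational_box ((\<lambda>i. (i, q i, r i)) ` ?E)" using qr by (auto simp: rational_box_def)
    have "y \<in> Pi\<^sub>E W V" if y: "y \<in> topspace (cube W)" "y \<in> rational_box ((\<lambda>i. (i, q i, r i)) ` ?E)" for y
    proof (rule PiE_I)
      fix i assume i: "i \<in> W"
      with y have "y i \<in> {0..1}" by (auto simp: topspace_cube PiE_iff)
      moreover have "y i \<in> {real_of_rat (q i)..real_of_rat (r i)}" if "V i \<noteq> {0..1}"
        using that i y(2) by (auto simp: rational_box_def)
      ultimately show "y i \<in> V i" using qr[OF i] by blast
    qed (use y in \<open>auto simp: topspace_cube PiE_iff extensional_def\<close>)
    then show "topspace (cube W) \<inter> rational_box ((\<lambda>i. (i, q i, r i)) ` ?E) \<subseteq> U" using V by blast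
  qed (use V in auto)
qed

lemma finitely_supported_neighbourhood:
  assumes "openin (cube W) U" "x \<in> U"
  obtains N E where "openin (cube W) N" "x \<in> N" "N \<subseteq> U" "finite E" "E \<subseteq> W"
    "\<forall>y y'. y \<in> N \<longrightarrow> y' \<in> topspace (cube W) \<longrightarrow> (\<forall>t\<in>E. y' t = y t) \<longrightarrow> y' \<in> N"
proof -
  obtain V where V: "finite {i \<in> W. V i \<noteq> {0..1}}" "\<And>i. i \<in> W \<Longrightarrow> openin (top_of_set {0..1::real}) (V i)"
    "x \<in> Pi\<^sub>E W V" "Pi\<^sub>E W V \<subseteq> U"
    using assms unfolding cube_def openin_product_topology_alt by force
  show thesis
  proof (rule that[of "Pi\<^sub>E W V" "{i \<in> W. V i \<noteq> {0..1}}"])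
    show "openin (cube W) (Pi\<^sub>E W V)"
      using V by (auto simp: cube_def openin_PiE_gen)
    have "y' \<in> Pi\<^sub>E W V" if y: "y \<in> Pi\<^sub>E W V" "y' \<in> topspace (cube W)"
      "\<forall>t\<in>{i \<in> W. V i \<noteq> {0..1}}. y' t = y t" for y y'
    proof (rule PiE_I)
      fix i assume "i \<in> W"
      with y show "y' i \<in> V i" by (cases "V i = {0..1}") (auto simp: topspace_cube PiE_iff)
    next
      fix i assume "i \<notin> W"
      with y show "y' i = undefined" by (auto simp: topspace_cube PiE_iff extensional_def)
    qed
    then show "\<forall>y y'. y \<in> Pi\<^sub>E W V \<longrightarrow> y' \<in> topspace (cube W) \<longrightarrow>
        (\<forall>t\<in>{i \<in> W. V i \<noteq> {0..1}}. y' t = y t) \<longrightarrow> y' \<in> Pi\<^sub>E W V" by blast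
  qed (use V in auto)
qed

text \<open>
  Compactness: finitely many members of the cover, and in them finitely many open sets that depend on
  finitely many coordinates each, already cover the cube.
\<close>

lemma cov_finite_support:
  assumes "\<U> \<in> cov (cube W)"
  shows "\<exists>E. finite E \<and> E \<subseteq> W \<and> (\<forall>y\<in>topspace (cube W). \<forall>y'\<in>topspace (cube W).
    (\<forall>t\<in>E. y' t = y t) \<longrightarrow> (\<exists>U\<in>\<U>. y' \<in> U \<and> y \<in> U))"
proof -
  define determined where "determined N E \<longleftrightarrow> finite E \<and> E \<subseteq> W \<and>
    (\<forall>y y'. y \<in> N \<longrightarrow> y' \<in> topspace (cube W) \<longrightarrow> (\<forall>t\<in>E. y' t = y t) \<longrightarrow> y' \<in> N)" for N E
  let ?\<N> = "{N. openin (cube W) N \<and> (\<exists>U\<in>\<U>. N \<subseteq> U) \<and> (\<exists>E. determined N E)}"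
  have op: "openin (cube W) U" if U: "U \<in> \<U>" for U
  proof -
    have "functionally_open (cube W) U" using assms U by (simp add: cov_def)
    then obtain f where f: "continuous_map (cube W) euclideanreal f"
      "U = {y \<in> topspace (cube W). f y \<noteq> 0}"
      unfolding functionally_open_def by (elim exE conjE)
    have "openin (cube W) {y \<in> topspace (cube W). f y \<in> - {0}}"
      by (rule openin_continuous_map_preimage[OF f(1)]) auto
    then show ?thesis using f(2) by simp
  qed
  have "x \<in> \<Union>?\<N>" if x: "x \<in> topspace (cube W)" for x
  proof -
    have "x \<in> \<Union>\<U>" using assms x by (simp add: cov_def)
    then obtain U where U: "U \<in> \<U>" "x \<in> U" by (elim UnionE)
    obtain N E where N: "openin (cube W) N" "x \<in> N" "N \<subseteq> U" "finite E" "E \<subseteq> W"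
      "\<forall>y y'. y \<in> N \<longrightarrow> y' \<in> topspace (cube W) \<longrightarrow> (\<forall>t\<in>E. y' t = y t) \<longrightarrow> y' \<in> N"
      by (rule finitely_supported_neighbourhood[OF op[OF U(1)] U(2)])
    then have "determined N E" by (simp add: determined_def)
    then show ?thesis using U(1) N(1-3) by blast
  qed
  then have "topspace (cube W) \<subseteq> \<Union>?\<N>" by (rule subsetI)
  moreover have "\<forall>N\<in>?\<N>. openin (cube W) N" by simp
  ultimately obtain \<F> where F: "finite \<F>" "\<F> \<subseteq> ?\<N>" "topspace (cube W) \<subseteq> \<Union>\<F>"
    using compact_space_cube[of W] unfolding compact_space_alt by meson
  have "\<forall>N\<in>\<F>. \<exists>E. determined N E" using F(2) by blast
  then obtain E where E: "\<forall>N\<in>\<F>. determined N (E N)" by (rule bchoice[THEN exE])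
  have "\<exists>U\<in>\<U>. y' \<in> U \<and> y \<in> U"
    if y: "y \<in> topspace (cube W)" "y' \<in> topspace (cube W)"
      and eq: "\<forall>t\<in>\<Union>(E ` \<F>). y' t = y t" for y y'
  proof -
    obtain N where N: "N \<in> \<F>" "y \<in> N" using F(3) y by blast
    have "\<forall>t\<in>E N. y' t = y t" using eq N(1) by blast
    moreover have "determined N (E N)" using E N(1) by simp
    ultimately have "y' \<in> N" using N(2) y(2) by (simp add: determined_def)
    moreover obtain U where "U \<in> \<U>" "N \<subseteq> U" using F(2) N(1) by blast
    ultimately show ?thesis using N(2) by blast
  qed
  moreover have "finite (\<Union>(E ` \<F>))" "\<Union>(E ` \<F>) \<subseteq> W"
    using F(1) E by (simp_all add: determined_def UN_least)
  ultimately show ?thesis by (intro exI[of _ "\<Union>(E ` \<F>)"] conjI ballI impI)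
qed

lemma closed_agreement_compactness:
  assumes M: "closedin (cube T) M" and D: "D \<subseteq> T"
    and fin: "\<And>E. finite E \<Longrightarrow> E \<subseteq> D \<Longrightarrow> \<exists>x\<in>M. \<forall>t\<in>E. x t = z t"
  obtains m where "m \<in> M" "\<forall>t\<in>D. m t = z t"
proof -
  let ?K = "\<lambda>t. {x \<in> topspace (cube T). x t \<in> {z t}}"
  have "compactin (cube T) M" by (rule closedin_compact_space[OF compact_space_cube M])
  moreover have "\<forall>C\<in>?K ` D. closedin (cube T) C"
  proof
    fix C assume "C \<in> ?K ` D"
    then obtain t where t: "t \<in> T" "C = ?K t" using D by blast
    show "closedin (cube T) C" unfolding t(2)
      by (rule closedin_continuous_map_preimage[OF continuous_map_coordinate[OF t(1)]]) simp
  qed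
  moreover have "M \<inter> \<Inter>\<F> \<noteq> {}" if F: "finite \<F>" "\<F> \<subseteq> ?K ` D" for \<F>
  proof -
    obtain E where E: "E \<subseteq> D" "finite E" "\<F> = ?K ` E" using finite_subset_image[OF F] by blast
    then obtain x where "x \<in> M" "\<forall>t\<in>E. x t = z t" using fin by blast
    moreover have "x \<in> topspace (cube T)" using \<open>x \<in> M\<close> M closedin_subset by blast
    ultimately have "x \<in> M \<inter> \<Inter>\<F>" using E by auto
    then show ?thesis by blast
  qed
  ultimately have "M \<inter> \<Inter>(?K ` D) \<noteq> {}" unfolding compactin_fip by blast
  then show thesis using that by blast
qed

section \<open>Fibres and omitted partial points\<close>

text \<open>
  The projection of \<open>M\<close> to the face with coordinates \<open>E\<close> is not onto.  The omitted point \<open>z\<close>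
  is total, so that the ambient cube may change.
\<close>

definition omits :: "('t \<Rightarrow> real) set \<Rightarrow> 't set \<Rightarrow> bool" where
  "omits M E \<longleftrightarrow> (\<exists>z \<in> UNIV \<rightarrow> {0..1}. \<forall>x\<in>M. \<exists>t\<in>E. x t \<noteq> z t)"

lemma omits_mono: "omits M E \<Longrightarrow> E \<subseteq> E' \<Longrightarrow> omits M E'"
  unfolding omits_def by blast

lemma omits_restrict: "E \<subseteq> W \<Longrightarrow> omits M E \<Longrightarrow> omits ((\<lambda>x. restrict x W) ` M) E"
  unfolding omits_def by (fastforce simp: subset_eq)

definition fibre_free :: "'k rel \<Rightarrow> 't set \<Rightarrow> ('t \<Rightarrow> real) set \<Rightarrow> bool" where
  "fibre_free r T M \<longleftrightarrow> (\<forall>S\<subseteq>T. |S| <o r \<longrightarrow>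
     (\<forall>y\<in>topspace (cube T). \<exists>x\<in>topspace (cube T) - M. \<forall>s\<in>S. x s = y s))"

text \<open>
  For \<open>M = {}\<close> even the empty set of coordinates omits a point; \<open>E \<noteq> {}\<close> makes disjoint sets
  \<open>E\<close> distinct in this case too.
\<close>

definition widely_omitting :: "'k rel \<Rightarrow> 't set \<Rightarrow> ('t \<Rightarrow> real) set \<Rightarrow> bool" where
  "widely_omitting r T M \<longleftrightarrow> (\<forall>S\<subseteq>T. |S| <o r \<longrightarrow>
     (\<exists>E. finite E \<and> E \<noteq> {} \<and> E \<subseteq> T - S \<and> omits M E))"

text \<open>
  The step from the absence of fibres to omitted points in finitely many coordinates.  A choice of a
  point outside \<open>M\<close> in each fibre over \<open>I\<^sup>S\<close> need not be continuous; the maximal system glues the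
  choices into one point \<open>z\<close> that serves all of \<open>I\<^sup>S\<close>, by giving different regions of \<open>I\<^sup>S\<close>
  different coordinates or equal values.
\<close>

lemma fibre_free_imp_widely_omitting:
  fixes r :: "'k rel" and T :: "'t set"
  assumes r: "Card_order r" "natLeq <o r" and T: "r \<le>o |T|"
    and M: "closedin (cube T) M" and ff: "fibre_free r T M"
  shows "widely_omitting r T M"
  unfolding widely_omitting_def
proof (intro allI impI)
  fix S assume S: "S \<subseteq> T" "|S| <o r"
  note inf = Cinfinite_if_uncountable[OF r]
  \<comment> \<open>A triple \<open>(c, E, x)\<close> records that no point of \<open>M\<close> in the box \<open>c\<close>, which constrains coordinates
    in \<open>S\<close>, agrees with \<open>x\<close> on \<open>E\<close>.  Distinct boxes in \<open>R\<close> bound the size of \<open>A\<close>, agreement on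
    common coordinates allows the partial points to be united.\<close>
  define P where "P = {(c, E, x). c \<in> Fpow (S \<times> (UNIV :: (rat \<times> rat) set)) \<and> finite E \<and> E \<subseteq> T - S \<and>
     x \<in> topspace (cube T) \<and> (\<forall>m\<in>M. m \<in> rational_box c \<longrightarrow> (\<exists>t\<in>E. m t \<noteq> x t))}"
  define R where "R = (\<lambda>(c :: ('t \<times> rat \<times> rat) set, E, x :: 't \<Rightarrow> real) (c', E', x').
     c \<noteq> c' \<and> (\<forall>t\<in>E \<inter> E'. x t = x' t))"
  obtain A where A: "A \<subseteq> P" "pairwise R A"
    and mx: "\<And>p. p \<in> P \<Longrightarrow> (\<And>a. a \<in> A \<Longrightarrow> R a p \<and> R p a) \<Longrightarrow> p \<in> A"
    using maximal_pairwise by blast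
  define D where "D = (\<Union>(c, E, x)\<in>A. E)"
  define z where "z t = (SOME v. \<exists>c E x. (c, E, x) \<in> A \<and> t \<in> E \<and> v = x t)" for t
  have z: "z t = x t" if a: "(c, E, x) \<in> A" "t \<in> E" for c E x t
  proof -
    have "\<exists>c E x. (c, E, x) \<in> A \<and> t \<in> E \<and> z t = x t"
      unfolding z_def by (rule someI_ex) (use a in blast)
    then obtain c' E' x' where "(c', E', x') \<in> A" "t \<in> E'" "z t = x' t" by blast
    then show ?thesis using A(2) a by (fastforce simp: pairwise_def R_def)
  qed
  have z01: "z t \<in> {0..1}" if t: "t \<in> D" for t
  proof -
    obtain c E x where a: "(c, E, x) \<in> A" "t \<in> E" using t unfolding D_def by blast
    then have "x \<in> topspace (cube T)" "t \<in> T" using A(1) by (auto simp: P_def)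
    then show ?thesis using z[OF a] by (auto simp: topspace_cube PiE_iff)
  qed
  have D_T: "D \<subseteq> T - S" using A(1) by (auto simp: D_def P_def)
  have "|A| <o r"
  proof -
    have "inj_on fst A" using A(2) by (fastforce simp: pairwise_def R_def inj_on_def)
    moreover have "fst ` A \<subseteq> Fpow (S \<times> (UNIV :: (rat \<times> rat) set))" using A(1) by (auto simp: P_def)
    ultimately have "|A| \<le>o |Fpow (S \<times> (UNIV :: (rat \<times> rat) set))|"
      by (intro card_of_ordLeq[THEN iffD1] exI[of _ fst] conjI)
    then show ?thesis
      using Fpow_ordLess[OF inf Times_countable_ordLess[OF r S(2) countableI_type]]
      by (rule ordLeq_ordLess_trans)
  qed
  then have "|D| <o r" unfolding D_def
    by (rule UN_finite_ordLess[OF inf]) (use A(1) in \<open>auto simp: P_def\<close>)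
  then have SD: "|S \<union> D| <o r" using S(2) by (intro Un_Cinfinite_bound_strict[OF _ _ inf])
  have "\<exists>E. finite E \<and> E \<subseteq> D \<and> (\<forall>x\<in>M. \<exists>t\<in>E. x t \<noteq> z t)"
  proof (rule ccontr)
    assume "\<not> ?thesis"
    then have hit: "\<exists>x\<in>M. \<forall>t\<in>E. x t = z t" if "finite E" "E \<subseteq> D" for E using that by meson
    have DT: "D \<subseteq> T" using D_T by blast
    obtain m where m: "m \<in> M" "\<forall>t\<in>D. m t = z t"
      by (rule closed_agreement_compactness[where z = z, OF M DT hit])
    have "m \<in> topspace (cube T)" using m(1) closedin_subset[OF M] by blast
    moreover have "S \<union> D \<subseteq> T" using S(1) D_T by blast
    ultimately obtain x where x: "x \<in> topspace (cube T) - M" "\<forall>s\<in>S \<union> D. x s = m s"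
      using ff SD unfolding fibre_free_def by meson
    obtain c where c: "finite c" "c \<subseteq> T \<times> UNIV" "x \<in> rational_box c"
        "topspace (cube T) \<inter> rational_box c \<subseteq> topspace (cube T) - M"
      by (rule rational_box_neighbourhood[OF openin_diff[OF openin_topspace M] x(1)])
    \<comment> \<open>The constraints in \<open>S\<close> stay a box, those outside are strengthened to equality with \<open>x\<close>.\<close>
    define c1 E1 where "c1 = c \<inter> S \<times> UNIV" and "E1 = fst ` c - S"
    have xc1: "x \<in> rational_box c1" using c(3) unfolding rational_box_def c1_def by blast
    have "\<exists>t\<in>E1. m' t \<noteq> x t" if m': "m' \<in> M" "m' \<in> rational_box c1" for m'
    proof (rule ccontr)
      assume *: "\<not> (\<exists>t\<in>E1. m' t \<noteq> x t)"
      have "m' \<in> rational_box c"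
        unfolding rational_box_def
      proof (clarify)
        fix s q r assume i: "(s, q, r) \<in> c"
        show "real_of_rat q \<le> m' s \<and> m' s \<le> real_of_rat r"
        proof (cases "s \<in> S")
          case True
          then have "(s, q, r) \<in> c1" using i by (simp add: c1_def)
          with m'(2) show ?thesis by (rule rational_boxD)
        next
          case False
          then have "m' s = x s" using i * by (force simp: E1_def)
          then show ?thesis using rational_boxD[OF c(3) i] by simp
        qed
      qed
      moreover have "m' \<in> topspace (cube T)" using m'(1) M closedin_subset by blast
      ultimately show False using c(4) m'(1) by blast
    qed
    then have p: "(c1, E1, x) \<in> P" using c x(1) by (auto simp: P_def c1_def E1_def Fpow_def)
    have "R a (c1, E1, x) \<and> R (c1, E1, x) a" if a: "a \<in> A" for a
    proof -
      obtain c' E' x' where a': "a = (c', E', x')" by (cases a)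
      \<comment> \<open>The point \<open>m\<close> lies in the box \<open>c1\<close> and agrees with every partial point in \<open>A\<close>,
        so it lies in no box of \<open>A\<close>.\<close>
      have "c' \<noteq> c1"
      proof
        assume "c' = c1"
        have "c1 \<subseteq> S \<times> UNIV" by (auto simp: c1_def)
        then have "m \<in> rational_box c'" using xc1 x(2) \<open>c' = c1\<close>
          unfolding rational_box_def by fastforce
        moreover have "(c', E', x') \<in> P" using A(1) a a' by blast
        ultimately obtain t where "t \<in> E'" "m t \<noteq> x' t" using m(1) by (auto simp: P_def)
        moreover have "t \<in> D" using \<open>t \<in> E'\<close> a a' by (auto simp: D_def)
        ultimately show False using m(2) z[of c' E' x' t] a a' by auto
      qed
      moreover have "x' t = x t" if "t \<in> E'" for t
      proof -
        have "t \<in> D" using that a a' by (auto simp: D_def)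
        then show ?thesis using z[of c' E' x' t] x(2) m(2) a a' that by auto
      qed
      ultimately show ?thesis by (auto simp: R_def a')
    qed
    \<comment> \<open>By maximality the new triple belongs to \<open>A\<close>, but \<open>R\<close> is irreflexive.\<close>
    note compatible = this
    have "(c1, E1, x) \<in> A" by (rule mx[OF p compatible])
    then have "R (c1, E1, x) (c1, E1, x)" using compatible by blast
    then show False by (simp add: R_def)
  qed
  then obtain E where E: "finite E" "E \<subseteq> D" "\<forall>x\<in>M. \<exists>t\<in>E. x t \<noteq> z t" by (elim exE conjE)
  \<comment> \<open>The set \<open>E\<close> may be empty if \<open>M\<close> is, hence an additional coordinate \<open>t\<close>.\<close>
  have "\<not> T \<subseteq> S"
  proof
    assume "T \<subseteq> S"
    then have "|T| \<le>o |S|" by (rule card_of_mono1)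
    then show False using S(2) T not_ordLess_ordLeq ordLeq_transitive by blast
  qed
  then obtain t where "t \<in> T" "t \<notin> S" by blast
  moreover have "omits M E"
    unfolding omits_def
    by (rule bexI[of _ "\<lambda>t. if t \<in> E then z t else 0"]) (use E z01 in \<open>auto simp: subset_eq\<close>)
  ultimately show "\<exists>E. finite E \<and> E \<noteq> {} \<and> E \<subseteq> T - S \<and> omits M E"
    using E D_T by (intro exI[of _ "insert t E"]) (auto intro: omits_mono)
qed

section \<open>Z-sets\<close>

text \<open>
  The common core of the two density arguments.  The map \<open>h\<close> is replaced by a constant partial point
  on coordinates which the covers do not see and which do not belong to \<open>R\<close>, so that \<open>g\<close> stays in
  the same fibres over \<open>R\<close>.
\<close>

lemma avoid_by_modification:
  assumes r: "Cinfinite r" and h: "h \<in> cmaps X (cube W)"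
    and C: "\<C> \<subseteq> cov (cube W)" "|\<C>| <o r"
    and om: "\<And>S. S \<subseteq> W \<Longrightarrow> |S| <o r \<Longrightarrow> \<exists>E\<subseteq>W - S - R. omits A E"
  obtains g where "g \<in> cmaps X (cube W)" "\<forall>\<U>\<in>\<C>. close_maps X \<U> g h" "g ` topspace X \<inter> A = {}"
    "\<forall>x\<in>topspace X. restrict (g x) R = restrict (h x) R"
proof -
  have hX: "h x \<in> topspace (cube W)" if "x \<in> topspace X" for x
    using h that by (auto simp: cmaps_def continuous_map_into_cube)
  have "\<exists>E. finite E \<and> E \<subseteq> W \<and> (\<forall>y\<in>topspace (cube W). \<forall>y'\<in>topspace (cube W).
      (\<forall>t\<in>E. y' t = y t) \<longrightarrow> (\<exists>U\<in>\<U>. y' \<in> U \<and> y \<in> U))" if U: "\<U> \<in> cov (cube W)" for \<U>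
    by (rule cov_finite_support[OF U])
  then obtain F where F: "\<And>\<U>. \<U> \<in> cov (cube W) \<Longrightarrow> finite (F \<U>) \<and> F \<U> \<subseteq> W \<and>
      (\<forall>y\<in>topspace (cube W). \<forall>y'\<in>topspace (cube W).
        (\<forall>t\<in>F \<U>. y' t = y t) \<longrightarrow> (\<exists>U\<in>\<U>. y' \<in> U \<and> y \<in> U))"
    by metis
  have F': "finite (F \<U>)" "F \<U> \<subseteq> W" if "\<U> \<in> \<C>" for \<U>
    using F[of \<U>] C(1) that by auto
  have "\<exists>E\<subseteq>W - (\<Union>\<U>\<in>\<C>. F \<U>) - R. omits A E"
    by (intro om UN_least F' UN_finite_ordLess[OF r C(2)])
  then obtain E where E: "E \<subseteq> W - (\<Union>\<U>\<in>\<C>. F \<U>) - R" "omits A E" by (elim exE conjE)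
  obtain z where z: "z \<in> UNIV \<rightarrow> {0..1}" "\<forall>x\<in>A. \<exists>t\<in>E. x t \<noteq> z t"
    using E(2) unfolding omits_def by (elim bexE)
  define g where "g = restrict (\<lambda>x t. if t \<in> E then z t else h x t) (topspace X)"
  have gX: "g x \<in> topspace (cube W)" if "x \<in> topspace X" for x
    using hX[OF that] z E(1) that by (auto simp: g_def topspace_cube PiE_iff extensional_def)
  have "continuous_map X euclideanreal (\<lambda>x. g x t)" if t: "t \<in> W" for t
  proof (rule continuous_map_eq)
    show "continuous_map X euclideanreal (\<lambda>x. if t \<in> E then z t else h x t)"
      using h t by (auto simp: cmaps_def continuous_map_into_cube)
  qed (simp add: g_def)
  then have g: "g \<in> cmaps X (cube W)"
    using gX by (auto simp: cmaps_def continuous_map_into_cube g_def)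
  show thesis
  proof (rule that[OF g])
    show "\<forall>\<U>\<in>\<C>. close_maps X \<U> g h"
      unfolding close_maps_def
    proof (intro ballI)
      fix \<U> x assume U: "\<U> \<in> \<C>" and x: "x \<in> topspace X"
      have "\<forall>t\<in>F \<U>. g x t = h x t" using E(1) U x by (auto simp: g_def)
      moreover have "\<U> \<in> cov (cube W)" using U C(1) by blast
      ultimately show "\<exists>U\<in>\<U>. g x \<in> U \<and> h x \<in> U"
        using F[of \<U>] gX[OF x] hX[OF x] by simp
    qed
    have "g x \<notin> A" if "x \<in> topspace X" for x
    proof
      assume "g x \<in> A"
      with z obtain t where "t \<in> E" "g x t \<noteq> z t" by blast
      with that show False by (simp add: g_def)
    qed
    then show "g ` topspace X \<inter> A = {}" by blast
    show "\<forall>x\<in>topspace X. restrict (g x) R = restrict (h x) R"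
      using E by (auto simp: g_def restrict_def fun_eq_iff)
  qed
qed

lemma widely_omitting_imp_Z_set:
  assumes r: "Cinfinite r" and M: "closedin (cube T) M" and wo: "widely_omitting r T M"
  shows "Z_set r (cube T) M"
proof -
  let ?X = "cube T"
  let ?D = "{f \<in> cmaps ?X ?X. f ` topspace ?X \<inter> M = {}}"
  have "\<exists>g\<in>?D. g \<in> G" if G: "C_open r ?X ?X G" "h \<in> G" for G h
  proof -
    obtain \<C> where C: "\<C> \<subseteq> cov ?X" "|\<C>| <o r"
      "\<And>g. g \<in> cmaps ?X ?X \<Longrightarrow> (\<forall>\<U>\<in>\<C>. close_maps ?X \<U> g h) \<Longrightarrow> g \<in> G"
      using G unfolding C_open_def by meson
    have h: "h \<in> cmaps ?X ?X" using G by (auto simp: C_open_def)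
    obtain g where "g \<in> cmaps ?X ?X" "\<forall>\<U>\<in>\<C>. close_maps ?X \<U> g h" "g ` topspace ?X \<inter> M = {}"
      by (rule avoid_by_modification[OF r h C(1,2), where R = "{}" and A = M])
        (use wo in \<open>auto simp: widely_omitting_def\<close>)
    then show ?thesis using C(3) by blast
  qed
  then have "dense_subset (C_space r ?X ?X) ?D"
    by (auto simp: dense_subset_def topspace_C_space[OF r] openin_C_space[OF r] in_closure_of)
  then show ?thesis using M by (simp add: Z_set_def)
qed

lemma separating_cover:
  assumes "s \<in> T" "q < r"
  shows "{{x \<in> topspace (cube T). x s < r}, {x \<in> topspace (cube T). q < x s}} \<in> cov (cube T)"
proof -
  have "functionally_open (cube T) {x \<in> topspace (cube T). x s < r}"
    unfolding functionally_open_def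
    by (rule exI[of _ "\<lambda>x. max 0 (r - x s)"])
      (auto intro!: continuous_intros continuous_map_real_max continuous_map_diff continuous_map_coordinate[OF assms(1)])
  moreover have "functionally_open (cube T) {x \<in> topspace (cube T). q < x s}"
    unfolding functionally_open_def
    by (rule exI[of _ "\<lambda>x. max 0 (x s - q)"])
      (auto intro!: continuous_map_real_max continuous_map_diff continuous_map_coordinate[OF assms(1)])
  ultimately show ?thesis using assms(2) by (auto simp: cov_def)
qed

text \<open>
  Two numbers that lie on different sides of a rational interval are separated by a cover with two
  members.  Uncountability of \<open>r\<close> leaves room for countably many such covers per coordinate, and
  being close with respect to all of them is equality.
\<close>

lemma C_open_agree_on_small:
  assumes r: "Card_order r" "natLeq <o r" and S: "S \<subseteq> T" "|S| <o r"
  shows "C_open r X (cube T) {g \<in> cmaps X (cube T). \<forall>x\<in>topspace X. \<forall>s\<in>S. g x s = h x s}"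
  (is "C_open _ _ _ ?G")
  unfolding C_open_def
proof (intro conjI ballI)
  fix h' assume h': "h' \<in> ?G"
  define I where "I = {(s, q, r') \<in> S \<times> (UNIV :: (rat \<times> rat) set). q < r'}"
  define U where "U = (\<lambda>(s, q, r'). {{x \<in> topspace (cube T). x s < real_of_rat r'},
     {x \<in> topspace (cube T). real_of_rat q < x s}})"
  have "U i \<in> cov (cube T)" if i: "i \<in> I" for i
  proof -
    obtain s q r' where "i = (s, q, r')" "s \<in> S" "q < r'" using i by (auto simp: I_def)
    then show ?thesis using S(1) separating_cover[of s T "real_of_rat q" "real_of_rat r'"]
      by (auto simp: U_def of_rat_less)
  qed
  then have "U ` I \<subseteq> cov (cube T)" by blast
  moreover have "|U ` I| <o r"
  proof -
    have "|I| \<le>o |S \<times> (UNIV :: (rat \<times> rat) set)|" by (rule card_of_mono1) (auto simp: I_def)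
    then show ?thesis using Times_countable_ordLess[OF r S(2), of "UNIV :: (rat \<times> rat) set"]
      by (meson card_of_image countableI_type ordLeq_ordLess_trans)
  qed
  moreover have "g \<in> ?G" if g: "g \<in> cmaps X (cube T)" "\<forall>\<U>\<in>U ` I. close_maps X \<U> g h'" for g
  proof -
    have "g x s = h' x s" if x: "x \<in> topspace X" and s: "s \<in> S" for x s
    proof (rule ccontr)
      assume ne: "g x s \<noteq> h' x s"
      define a b where "a = min (g x s) (h' x s)" and "b = max (g x s) (h' x s)"
      have "a < b" using ne by (auto simp: a_def b_def)
      \<comment> \<open>Of the two values, \<open>a\<close> lies only in the first member of the cover for \<open>q < r'\<close> and \<open>b\<close>
        only in the second.\<close>
      then obtain q where q: "a < real_of_rat q" "real_of_rat q < b" using of_rat_dense by blast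
      then obtain r' where r': "real_of_rat q < real_of_rat r'" "real_of_rat r' < b" using of_rat_dense by blast
      have "U (s, q, r') \<in> U ` I" using s r' by (intro imageI) (auto simp: I_def of_rat_less)
      with g(2) have "close_maps X (U (s, q, r')) g h'" by (rule bspec)
      then have "\<exists>V\<in>U (s, q, r'). g x \<in> V \<and> h' x \<in> V" using x by (simp add: close_maps_def)
      then show False using q r' by (auto simp: U_def a_def b_def min_def max_def split: if_splits)
    qed
    then show ?thesis using h' g by auto
  qed
  ultimately show "\<exists>\<C>\<subseteq>cov (cube T). |\<C>| <o r \<and>
      (\<forall>g\<in>cmaps X (cube T). (\<forall>\<U>\<in>\<C>. close_maps X \<U> g h') \<longrightarrow> g \<in> ?G)"
    by (intro exI[of _ "U ` I"]) auto
qed auto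

lemma Z_set_imp_fibre_free:
  assumes r: "Card_order r" "natLeq <o r" and Z: "Z_set r (cube T) M"
  shows "fibre_free r T M"
  unfolding fibre_free_def
proof (intro allI impI ballI)
  fix S y assume S: "S \<subseteq> T" "|S| <o r" and y: "y \<in> topspace (cube T)"
  let ?X = "cube T"
  let ?id = "restrict id (topspace ?X)"
  let ?G = "{g \<in> cmaps ?X ?X. \<forall>x\<in>topspace ?X. \<forall>s\<in>S. g x s = ?id x s}"
  note inf = Cinfinite_if_uncountable[OF r]
  have "?id \<in> cmaps ?X ?X"
    by (auto simp: cmaps_def intro: continuous_map_eq[OF continuous_map_id])
  then have "?id \<in> topspace (C_space r ?X ?X)" "?id \<in> ?G" by (auto simp: topspace_C_space[OF inf])
  moreover have "openin (C_space r ?X ?X) ?G"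
    using C_open_agree_on_small[OF r S] by (simp add: openin_C_space[OF inf])
  ultimately obtain g where "g \<in> ?G" "g ` topspace ?X \<inter> M = {}"
    using Z unfolding Z_set_def dense_subset_def
    by (smt (verit, ccfv_threshold) in_closure_of mem_Collect_eq)
  then have "g y \<in> topspace ?X - M" "\<forall>s\<in>S. g y s = y s"
    using y by (auto simp: cmaps_def continuous_map_into_cube)
  then show "\<exists>x\<in>topspace ?X - M. \<forall>s\<in>S. x s = y s" by blast
qed

section \<open>Pseudocharacter\<close>

text \<open>
  A point outside \<open>F\<close> lies in a closed rational box disjoint from \<open>F\<close>, so \<open>F\<close> is the
  intersection of the complements of such boxes.
\<close>

lemma small_pseudo_base:
  assumes r: "Cinfinite r" and T: "|T| \<le>o r" and F: "closedin (cube T) F"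
  obtains \<V> where "pseudo_base (cube T) F \<V>" "|\<V>| \<le>o r"
proof -
  let ?X = "topspace (cube T)"
  define I where "I = {c \<in> Fpow (T \<times> (UNIV :: (rat \<times> rat) set)). F \<inter> rational_box c = {}}"
  define \<V> where "\<V> = insert ?X ((\<lambda>c. ?X - ?X \<inter> rational_box c) ` I)"
  have "openin (cube T) V" if "V \<in> \<V>" for V
    using that by (auto simp: \<V>_def I_def Fpow_def intro!: openin_diff closedin_rational_box)
  moreover have "\<Inter>\<V> \<subseteq> F"
  proof
    fix x assume x: "x \<in> \<Inter>\<V>"
    then have xX: "x \<in> ?X" by (simp add: \<V>_def)
    show "x \<in> F"
    proof (rule ccontr)
      assume "x \<notin> F"
      with xX have "x \<in> ?X - F" by blast
      then obtain c where c: "finite c" "c \<subseteq> T \<times> UNIV" "x \<in> rational_box c" "?X \<inter> rational_box c \<subseteq> ?X - F"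
        by (rule rational_box_neighbourhood[OF openin_diff[OF openin_topspace F]])
      then have "c \<in> I" using closedin_subset[OF F] by (auto simp: I_def Fpow_def)
      then have "?X - ?X \<inter> rational_box c \<in> \<V>" by (simp add: \<V>_def)
      with x c(3) show False by blast
    qed
  qed
  moreover have "F \<subseteq> \<Inter>\<V>" using closedin_subset[OF F] by (auto simp: \<V>_def I_def)
  ultimately have "pseudo_base (cube T) F \<V>" unfolding pseudo_base_def
    by (intro conjI ballI equalityI) (simp add: \<V>_def)
  moreover have "|\<V>| \<le>o r"
  proof -
    have "natLeq \<le>o r" using r by (rule natLeq_ordLeq_cinfinite)
    moreover have "|UNIV :: (rat \<times> rat) set| \<le>o natLeq" by (simp add: countable_card_le_natLeq[symmetric])
    ultimately have "|UNIV :: (rat \<times> rat) set| \<le>o r" by (rule ordLeq_transitive[rotated])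
    then have "|T \<times> (UNIV :: (rat \<times> rat) set)| \<le>o r"
      using r T by (intro card_of_Times_ordLeq_infinite_Field) (auto simp: cinfinite_def)
    then have "|Fpow (T \<times> (UNIV :: (rat \<times> rat) set))| \<le>o r" by (rule Fpow_infinite_bound[OF r])
    moreover have "|I| \<le>o |Fpow (T \<times> (UNIV :: (rat \<times> rat) set))|"
      by (rule card_of_mono1) (auto simp: I_def)
    ultimately have "|I| \<le>o r" by (rule ordLeq_transitive[rotated])
    then have "|(\<lambda>c. ?X - ?X \<inter> rational_box c) ` I| \<le>o r" by (rule ordLeq_transitive[OF card_of_image])
    moreover have "|{?X}| \<le>o r" by (rule ordLess_imp_ordLeq[OF finite_ordLess_Cinfinite[OF r]]) simp
    ultimately have "|{?X} \<union> (\<lambda>c. ?X - ?X \<inter> rational_box c) ` I| \<le>o r" using r by (intro Un_Cinfinite_bound)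
    then show ?thesis by (simp add: \<V>_def)
  qed
  ultimately show thesis by (rule that)
qed

lemma pseudocharacter_fibre:
  assumes r: "Card_order r" "natLeq <o r" and S: "S \<subseteq> T" "|S| <o r" and y: "y \<in> topspace (cube T)"
  shows "pseudocharacter {x \<in> topspace (cube T). \<forall>s\<in>S. x s = y s} (cube T) <o r"
proof -
  let ?X = "topspace (cube T)"
  note inf = Cinfinite_if_uncountable[OF r]
  define V where "V = (\<lambda>(s, n :: nat). {x \<in> ?X. x s \<in> ball (y s) (1 / Suc n)})"
  define \<V> where "\<V> = insert ?X (V ` (S \<times> UNIV))"
  have op: "openin (cube T) (V (s, n))" if s: "s \<in> S" for s n
  proof -
    have "s \<in> T" using s S(1) by blast
    then show ?thesis unfolding V_def case_prod_conv
      by (rule openin_continuous_map_preimage[OF continuous_map_coordinate]) simp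
  qed
  have "x s = y s" if x: "x \<in> \<Inter>\<V>" and s: "s \<in> S" for x s
  proof (rule ccontr)
    assume "x s \<noteq> y s"
    then have "dist (y s) (x s) > 0" by simp
    then obtain n where n: "1 / Suc n < dist (y s) (x s)" by (rule nat_approx_posE)
    have "V (s, n) \<in> \<V>" using s by (simp add: \<V>_def)
    with x n show False by (auto simp: V_def)
  qed
  moreover have "?X \<in> \<V>" by (simp add: \<V>_def)
  ultimately have "\<Inter>\<V> \<subseteq> {x \<in> ?X. \<forall>s\<in>S. x s = y s}" by blast
  moreover have "x \<in> U" if x: "x \<in> ?X" "\<forall>s\<in>S. x s = y s" and U: "U \<in> \<V>" for x U
  proof (cases "U = ?X")
    case False
    then obtain s n where "s \<in> S" "U = V (s, n)" using U unfolding \<V>_def by blast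
    then show ?thesis using x by (simp add: V_def)
  qed (use x in simp)
  ultimately have "\<Inter>\<V> = {x \<in> ?X. \<forall>s\<in>S. x s = y s}" by blast
  moreover have "openin (cube T) U" if U: "U \<in> \<V>" for U
  proof (cases "U = ?X")
    case False
    then obtain s n where "s \<in> S" "U = V (s, n)" using U unfolding \<V>_def by blast
    then show ?thesis using op by simp
  qed simp
  ultimately have "pseudo_base (cube T) {x \<in> ?X. \<forall>s\<in>S. x s = y s} \<V>"
    unfolding pseudo_base_def by (intro conjI ballI) (simp add: \<V>_def)
  then have "pseudocharacter {x \<in> ?X. \<forall>s\<in>S. x s = y s} (cube T) \<le>o |\<V>|"
    by (rule pseudocharacter_least(2)) fact
  moreover have "|\<V>| <o r"
  proof -
    have "|V ` (S \<times> UNIV)| <o r"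
      by (rule ordLeq_ordLess_trans[OF card_of_image Times_countable_ordLess[OF r S(2) countableI_type]])
    then have "|{?X} \<union> V ` (S \<times> UNIV)| <o r"
      using finite_ordLess_Cinfinite[OF inf, of "{?X}"] inf by (intro Un_Cinfinite_bound_strict) auto
    then show ?thesis by (simp add: \<V>_def)
  qed
  ultimately show ?thesis by (rule ordLeq_ordLess_trans)
qed

text \<open>
  Each member of a family of open sets with intersection \<open>F\<close> contains, around a point of \<open>F\<close>, a
  fibre over finitely many coordinates.  If the family has fewer than \<open>r\<close> members, the intersection
  of these is a fibre over fewer than \<open>r\<close> coordinates, and it is contained in \<open>F\<close>.
\<close>

lemma fibre_free_iff_pseudocharacter:
  fixes r :: "'k rel" and T :: "'t set"
  assumes r: "Card_order r" "natLeq <o r" and T: "|T| =o r" and M: "closedin (cube T) M"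
  shows "fibre_free r T M \<longleftrightarrow>
    (\<forall>F. F \<subseteq> M \<and> F \<noteq> {} \<and> closedin (cube T) F \<longrightarrow> pseudocharacter F (cube T) =o r)"
    (is "_ \<longleftrightarrow> ?rhs")
proof
  note inf = Cinfinite_if_uncountable[OF r]
  assume ff: "fibre_free r T M"
  show ?rhs
  proof (intro allI impI; elim conjE)
    fix F assume F: "F \<subseteq> M" "F \<noteq> {}" "closedin (cube T) F"
    obtain \<V> where V: "pseudo_base (cube T) F \<V>" "|\<V>| \<le>o r"
      by (rule small_pseudo_base[OF inf ordIso_imp_ordLeq[OF T] F(3)])
    obtain \<U> where U: "pseudo_base (cube T) F \<U>" "pseudocharacter F (cube T) = |\<U>|"
      using pseudocharacter_least(1)[OF V(1)] by (elim exE conjE)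
    have "\<not> |\<U>| <o r"
    proof
      assume less: "|\<U>| <o r"
      obtain x where x: "x \<in> F" using F(2) by blast
      have "\<exists>E. finite E \<and> E \<subseteq> T \<and> (\<forall>x'\<in>topspace (cube T). (\<forall>t\<in>E. x' t = x t) \<longrightarrow> x' \<in> U)"
        if U': "U \<in> \<U>" for U
      proof -
        have "openin (cube T) U" "x \<in> U" using U(1) U' x by (auto simp: pseudo_base_def)
        then obtain N E where N: "x \<in> N" "N \<subseteq> U" "finite E" "E \<subseteq> T"
          "\<forall>y y'. y \<in> N \<longrightarrow> y' \<in> topspace (cube T) \<longrightarrow> (\<forall>t\<in>E. y' t = y t) \<longrightarrow> y' \<in> N"
          by (rule finitely_supported_neighbourhood)
        have "x' \<in> U" if "x' \<in> topspace (cube T)" "\<forall>t\<in>E. x' t = x t" for x'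
          using N(5)[rule_format, of x x'] N(1,2) that by auto
        then show ?thesis using N(3,4) by (intro exI[of _ E] conjI ballI impI)
      qed
      then have "\<forall>U\<in>\<U>. \<exists>E. finite E \<and> E \<subseteq> T \<and>
          (\<forall>x'\<in>topspace (cube T). (\<forall>t\<in>E. x' t = x t) \<longrightarrow> x' \<in> U)" by (rule ballI)
      then obtain E where E: "\<forall>U\<in>\<U>. finite (E U) \<and> E U \<subseteq> T \<and>
          (\<forall>x'\<in>topspace (cube T). (\<forall>t\<in>E U. x' t = x t) \<longrightarrow> x' \<in> U)" by (rule bchoice[THEN exE])
      have "|\<Union>U\<in>\<U>. E U| <o r" using E by (intro UN_finite_ordLess[OF inf less]) simp
      moreover have "(\<Union>U\<in>\<U>. E U) \<subseteq> T" using E by (simp add: UN_least)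
      moreover have "x \<in> topspace (cube T)" using x F(3) closedin_subset by blast
      ultimately obtain x' where x': "x' \<in> topspace (cube T) - M" "\<forall>s\<in>\<Union>U\<in>\<U>. E U. x' s = x s"
        using ff unfolding fibre_free_def by meson
      have "x' \<in> U" if "U \<in> \<U>" for U using E x' that by simp
      then have "x' \<in> F" using U(1) by (auto simp: pseudo_base_def)
      then show False using x' F(1) by blast
    qed
    then have "r \<le>o |\<U>|" 
      using ordLess_or_ordLeq[OF card_of_Well_order card_order_on_well_order_on[OF r(1)]] by blast
    moreover have "|\<U>| \<le>o r"
      using ordLeq_transitive[OF pseudocharacter_least(2)[OF V(1) V(1)] V(2)] U(2) by simp
    ultimately show "pseudocharacter F (cube T) =o r" using U(2) by (simp add: ordIso_iff_ordLeq)
  qed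
next
  assume rhs: ?rhs
  show "fibre_free r T M"
    unfolding fibre_free_def
  proof (intro allI impI ballI, rule ccontr)
    fix S y assume S: "S \<subseteq> T" "|S| <o r" and y: "y \<in> topspace (cube T)"
      and "\<not> (\<exists>x\<in>topspace (cube T) - M. \<forall>s\<in>S. x s = y s)"
    let ?F = "{x \<in> topspace (cube T). \<forall>s\<in>S. x s = y s}"
    have "?F \<subseteq> M" using \<open>\<not> _\<close> by blast
    moreover have "?F \<noteq> {}" using y by blast
    moreover have "closedin (cube T) ?F"
    proof -
      let ?K = "\<lambda>s. {x \<in> topspace (cube T). x s \<in> {y s}}"
      have "closedin (cube T) (?K s)" if s: "s \<in> S" for s
      proof -
        have "s \<in> T" using s S(1) by blast
        then show ?thesis
          by (intro closedin_continuous_map_preimage[OF continuous_map_coordinate]) simp_all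
      qed
      then have "closedin (cube T) (\<Inter>(insert (topspace (cube T)) (?K ` S)))"
        by (intro closedin_Inter) blast+
      moreover have "\<Inter>(insert (topspace (cube T)) (?K ` S)) = ?F" by fastforce
      ultimately show ?thesis by simp
    qed
    ultimately have "pseudocharacter ?F (cube T) =o r" using rhs by blast
    then show False using pseudocharacter_fibre[OF r S y] not_ordLess_ordIso by blast
  qed
qed

section \<open>Fibered Z-sets\<close>

lemma fibered_Z_setI:
  assumes A: "closedin (cube W) A"
    and om: "\<And>S. S \<subseteq> W \<Longrightarrow> finite S \<Longrightarrow> \<exists>E\<subseteq>W - S - R. omits A E"
  shows "fibered_Z_set (cube W) (\<lambda>x. restrict x R) A"
proof -
  let ?X = "cube W" and ?p = "\<lambda>x :: 'a \<Rightarrow> real. restrict x R"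
  let ?D = "{f \<in> fibered_cmaps ?X ?p. f ` topspace ?X \<inter> A = {}}"
  let ?C = "C_space natLeq ?X ?X"
  have "\<exists>g\<in>?D. g \<in> G" if G: "C_open natLeq ?X ?X G" "h \<in> G" and h: "h \<in> fibered_cmaps ?X ?p" for G h
  proof -
    obtain \<C> where C: "\<C> \<subseteq> cov ?X" "|\<C>| <o natLeq"
      "\<forall>g\<in>cmaps ?X ?X. (\<forall>\<U>\<in>\<C>. close_maps ?X \<U> g h) \<longrightarrow> g \<in> G"
      using G unfolding C_open_def by meson
    have h': "h \<in> cmaps ?X ?X" using h by (simp add: fibered_cmaps_def)
    obtain g where g: "g \<in> cmaps ?X ?X" "\<forall>\<U>\<in>\<C>. close_maps ?X \<U> g h" "g ` topspace ?X \<inter> A = {}"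
      "\<forall>x\<in>topspace ?X. ?p (g x) = ?p (h x)"
    proof (rule avoid_by_modification[OF natLeq_Cinfinite h' C(1,2), where R = R and A = A])
      show "\<exists>E\<subseteq>W - S - R. omits A E" if "S \<subseteq> W" "|S| <o natLeq" for S
        using that by (intro om) (simp_all add: finite_iff_ordLess_natLeq)
    qed
    then have "g \<in> G" using C(3) by blast
    moreover have "g \<in> fibered_cmaps ?X ?p" using g h by (simp add: fibered_cmaps_def)
    ultimately show ?thesis using g(3) by blast
  qed
  note dense = this
  have top: "topspace (subtopology ?C (fibered_cmaps ?X ?p)) = fibered_cmaps ?X ?p"
    by (auto simp: topspace_C_space[OF natLeq_Cinfinite] fibered_cmaps_def)
  have "h \<in> subtopology ?C (fibered_cmaps ?X ?p) closure_of ?D" if h: "h \<in> fibered_cmaps ?X ?p" for h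
    unfolding in_closure_of top
  proof (intro conjI allI impI h)
    fix U assume U: "h \<in> U \<and> openin (subtopology ?C (fibered_cmaps ?X ?p)) U"
    then obtain G where G: "openin ?C G" "U = G \<inter> fibered_cmaps ?X ?p"
      unfolding openin_subtopology by blast
    then have "C_open natLeq ?X ?X G" "h \<in> G"
      using U by (simp_all add: openin_C_space[OF natLeq_Cinfinite])
    then obtain g where "g \<in> ?D" "g \<in> G" using dense h by blast
    then show "\<exists>g. g \<in> ?D \<and> g \<in> U" using G(2) by blast
  qed
  then have "dense_subset (subtopology ?C (fibered_cmaps ?X ?p)) ?D"
    unfolding dense_subset_def top
    using closure_of_subset_topspace[of "subtopology ?C (fibered_cmaps ?X ?p)" ?D] top by blast
  then show ?thesis using A by (simp add: fibered_Z_set_def)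
qed

text \<open>
  The fibrewise self-maps include the identity, so density yields one that leaves \<open>A\<close>: no fibre of
  the projection is contained in \<open>A\<close>.
\<close>

lemma fibered_Z_set_meets_complement:
  assumes Z: "fibered_Z_set (cube W) (\<lambda>x. restrict x R) A" and x: "x \<in> topspace (cube W)"
  obtains w where "w \<in> topspace (cube W) - A" "restrict w R = restrict x R"
proof -
  let ?X = "cube W" and ?p = "\<lambda>x :: 'a \<Rightarrow> real. restrict x R"
  let ?C = "subtopology (C_space natLeq ?X ?X) (fibered_cmaps ?X ?p)"
  have "restrict id (topspace ?X) \<in> fibered_cmaps ?X ?p"
    by (auto simp: fibered_cmaps_def cmaps_def intro: continuous_map_eq[OF continuous_map_id])
  then have "topspace ?C \<noteq> {}"
    by (auto simp: topspace_C_space[OF natLeq_Cinfinite] fibered_cmaps_def)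
  then have "{f \<in> fibered_cmaps ?X ?p. f ` topspace ?X \<inter> A = {}} \<noteq> {}"
    using Z unfolding fibered_Z_set_def dense_subset_def by (metis closure_of_empty)
  then obtain f where f: "f \<in> fibered_cmaps ?X ?p" "f ` topspace ?X \<inter> A = {}" by blast
  show thesis
  proof (rule that[of "f x"])
    have "f x \<in> topspace ?X"
      using f(1) x by (simp add: fibered_cmaps_def cmaps_def continuous_map_into_cube)
    then show "f x \<in> topspace ?X - A" using f(2) x by blast
    show "restrict (f x) R = restrict x R" using f(1) x by (simp add: fibered_cmaps_def)
  qed
qed

section \<open>Filtrations indexed by the ordinals below a cardinal\<close>

lemma ord_succ_props:
  assumes r: "Card_order r" "infinite (Field r)" and a: "a \<in> Field r"
  shows "ord_succ r a \<in> Field r" "(a, ord_succ r a) \<in> r" "a \<noteq> ord_succ r a"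
    "underS r (ord_succ r a) = insert a (underS r a)"
    "\<And>b. (a, b) \<in> r \<Longrightarrow> a \<noteq> b \<Longrightarrow> (ord_succ r a, b) \<in> r"
proof -
  have wo: "wo_rel r" using card_order_on_well_order_on[OF r(1)] by (simp add: wo_rel_def)
  have A: "AboveS r {a} \<noteq> {}"
  proof -
    obtain b where "b \<in> Field r" "a \<noteq> b" "(a, b) \<in> r" using infinite_Card_order_limit[OF r a] by blast
    then have "b \<in> AboveS r {a}" by (simp add: AboveS_def)
    then show ?thesis by blast
  qed
  show F: "ord_succ r a \<in> Field r" unfolding ord_succ_def by (rule wo_rel.suc_inField[OF wo]) (use a A in auto)
  have "wo_rel.suc r {a} \<noteq> a \<and> (a, wo_rel.suc r {a}) \<in> r" by (rule wo_rel.suc_greater[OF wo]) (use a A in auto)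
  then show less: "(a, ord_succ r a) \<in> r" "a \<noteq> ord_succ r a" by (auto simp: ord_succ_def)
  show least: "(ord_succ r a, b) \<in> r" if "(a, b) \<in> r" "a \<noteq> b" for b
    unfolding ord_succ_def using that by (intro wo_rel.suc_least_AboveS[OF wo]) (auto simp: AboveS_def Field_def)
  show "underS r (ord_succ r a) = insert a (underS r a)"
  proof (intro equalityI subsetI)
    fix b assume "b \<in> underS r (ord_succ r a)"
    then have b: "(b, ord_succ r a) \<in> r" "b \<noteq> ord_succ r a" by (auto simp: underS_def)
    have "(a, b) \<notin> r" if "a \<noteq> b"
      using antisymD[OF wo_rel.ANTISYM[OF wo] b(1)] least[of b] b(2) that by blast
    moreover have "b \<in> Field r" using b(1) by (auto simp: Field_def)
    ultimately have "b = a \<or> (b, a) \<in> r" using wo_rel.TOTALS[OF wo] a by blast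
    then show "b \<in> insert a (underS r a)" by (auto simp: underS_def)
  next
    fix b assume b: "b \<in> insert a (underS r a)"
    show "b \<in> underS r (ord_succ r a)"
    proof (cases "b = a")
      case True
      then show ?thesis using less by (simp add: underS_def)
    next
      case False
      then have b: "(b, a) \<in> r" using b by (simp add: underS_def)
      have "(b, ord_succ r a) \<in> r" using wo_rel.TRANS[OF wo] b less(1) by (rule transD)
      moreover have "b \<noteq> ord_succ r a"
        using antisymD[OF wo_rel.ANTISYM[OF wo] b] less False by blast
      ultimately show ?thesis by (simp add: underS_def)
    qed
  qed
qed

lemma ord_zero_props:
  assumes r: "Card_order r" "Field r \<noteq> {}"
  shows "ord_zero r \<in> Field r" "\<And>a. a \<in> Field r \<Longrightarrow> (ord_zero r, a) \<in> r" "underS r (ord_zero r) = {}"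
proof -
  have wo: "wo_rel r" using card_order_on_well_order_on[OF r(1)] by (simp add: wo_rel_def)
  show "ord_zero r \<in> Field r" unfolding ord_zero_def by (rule wo_rel.minim_inField[OF wo]) (use r in auto)
  show least: "(ord_zero r, a) \<in> r" if "a \<in> Field r" for a
    unfolding ord_zero_def by (rule wo_rel.minim_least[OF wo]) (use that in auto)
  show "underS r (ord_zero r) = {}"
    using least wo_rel.ANTISYM[OF wo] unfolding underS_def antisym_def by (auto simp: Field_def)
qed

definition fibered_Z_filtration :: "'k rel \<Rightarrow> 't set \<Rightarrow> ('t \<Rightarrow> real) set \<Rightarrow> ('k \<Rightarrow> 't set) \<Rightarrow> bool" where
  "fibered_Z_filtration r T M S \<longleftrightarrow>
              (\<forall>\<alpha> \<beta>. (\<alpha>, \<beta>) \<in> r \<longrightarrow> S \<alpha> \<subseteq> S \<beta>) \<and>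
              T = (\<Union>\<alpha>\<in>Field r. S \<alpha>) \<and>
              |S (ord_zero r)| =o natLeq \<and>
              (\<forall>\<alpha>\<in>Field r. |S (ord_succ r \<alpha>) - S \<alpha>| =o natLeq) \<and>
              (\<forall>\<alpha>. ord_limit r \<alpha> \<longrightarrow> S \<alpha> = (\<Union>\<beta>\<in>underS r \<alpha>. S \<beta>)) \<and>
              (\<forall>\<alpha>\<in>Field r.
                 fibered_Z_set (cube (S (ord_succ r \<alpha>))) (\<lambda>x. restrict x (S \<alpha>))
                   ((\<lambda>x. restrict x (S (ord_succ r \<alpha>))) ` M))"

text \<open>
  Fewer than \<open>r\<close> coordinates miss one of the \<open>r\<close> disjoint layers of the filtration.  A fibre of
  \<open>I\<^sup>T\<close> inside \<open>M\<close> then projects onto a set which puts no condition on that layer.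
\<close>

lemma filtration_imp_fibre_free:
  fixes r :: "'k rel" and T :: "'t set"
  assumes r: "Card_order r" "infinite (Field r)" and flt: "fibered_Z_filtration r T M S"
  shows "fibre_free r T M"
  unfolding fibre_free_def
proof (intro allI impI ballI, rule ccontr)
  fix S0 y assume S0: "S0 \<subseteq> T" "|S0| <o r" and y: "y \<in> topspace (cube T)"
    and no: "\<not> (\<exists>x\<in>topspace (cube T) - M. \<forall>s\<in>S0. x s = y s)"
  have mono: "S \<alpha> \<subseteq> S \<beta>" if "(\<alpha>, \<beta>) \<in> r" for \<alpha> \<beta> using flt that by (simp add: fibered_Z_filtration_def)
  have sub: "S \<alpha> \<subseteq> T" if "\<alpha> \<in> Field r" for \<alpha>
    using flt that unfolding fibered_Z_filtration_def by blast
  have wo_r: "wo_rel r" using card_order_on_well_order_on[OF r(1)] by (simp add: wo_rel_def)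
  let ?D = "\<lambda>\<alpha>. S (ord_succ r \<alpha>) - S \<alpha>"
  have disj': "?D \<alpha> \<inter> ?D \<beta> = {}" if "(\<alpha>, \<beta>) \<in> r" "\<alpha> \<noteq> \<beta>" "\<alpha> \<in> Field r" for \<alpha> \<beta>
    using mono[OF ord_succ_props(5)[OF r that(3,1,2)]] by blast
  have disj: "?D \<alpha> \<inter> ?D \<beta> = {}" if "\<alpha> \<in> Field r" "\<beta> \<in> Field r" "\<alpha> \<noteq> \<beta>" for \<alpha> \<beta>
  proof -
    have "(\<alpha>, \<beta>) \<in> r \<or> (\<beta>, \<alpha>) \<in> r" using wo_rel.TOTALS[OF wo_r] that by blast
    then show ?thesis
    proof
      assume "(\<alpha>, \<beta>) \<in> r"
      then show ?thesis using that by (intro disj')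
    next
      assume "(\<beta>, \<alpha>) \<in> r"
      then have "?D \<beta> \<inter> ?D \<alpha> = {}" using that by (intro disj') simp_all
      then show ?thesis by (simp only: Int_commute)
    qed
  qed
  have "\<exists>\<alpha>\<in>Field r. ?D \<alpha> \<inter> S0 = {}"
  proof (rule ccontr)
    assume "\<not> ?thesis"
    then have "|Field r| \<le>o |S0|"
      by (intro card_of_choice_le[of _ ?D] disj) blast+
    then have "r \<le>o |S0|" by (rule ordIso_ordLeq_trans[OF ordIso_symmetric[OF card_of_Field_ordIso[OF r(1)]]])
    then show False using S0(2) not_ordLess_ordLeq by blast
  qed
  then obtain \<alpha> where \<alpha>: "\<alpha> \<in> Field r" "?D \<alpha> \<inter> S0 = {}" by blast
  let ?W = "S (ord_succ r \<alpha>)"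
  have W: "?W \<subseteq> T" by (rule sub[OF ord_succ_props(1)[OF r \<alpha>(1)]])
  have Z: "fibered_Z_set (cube ?W) (\<lambda>x. restrict x (S \<alpha>)) ((\<lambda>x. restrict x ?W) ` M)"
    using flt \<alpha>(1) by (simp add: fibered_Z_filtration_def)
  have "restrict y ?W \<in> topspace (cube ?W)" using y W by (auto simp: topspace_cube)
  then obtain w where w: "w \<in> topspace (cube ?W) - (\<lambda>x. restrict x ?W) ` M"
    "restrict w (S \<alpha>) = restrict (restrict y ?W) (S \<alpha>)"
    by (rule fibered_Z_set_meets_complement[OF Z])
  \<comment> \<open>In the layer \<open>S\<^sub>\<alpha>\<^sub>+\<^sub>1 - S\<^sub>\<alpha>\<close> the values of \<open>w\<close> are used; they cannot conflict with \<open>y\<close> on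
    \<open>S0\<close>, which is disjoint from the layer.\<close>
  define v where "v = (\<lambda>t. if t \<in> ?W then w t else y t)"
  have v: "v \<in> topspace (cube T)" using w(1) y W by (auto simp: v_def topspace_cube PiE_iff extensional_def)
  have "v s = y s" if s: "s \<in> S0" for s
  proof (cases "s \<in> ?W")
    case True
    then have "s \<in> S \<alpha>" using \<alpha>(2) s by blast
    then have "w s = y s" using fun_cong[OF w(2), of s] True by simp
    then show ?thesis using True by (simp add: v_def)
  qed (simp add: v_def)
  then have "v \<in> M" using no v by blast
  moreover have "restrict v ?W = w"
    using w(1) by (auto simp: v_def topspace_cube PiE_iff extensional_def restrict_def fun_eq_iff)
  ultimately show False using w(1) by blast
qed

text \<open>
  A maximal disjoint family of omitting sets has at least \<open>r\<close> members, since otherwise its union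
  would be a small set of coordinates and an omitting set outside it could be added.
\<close>

lemma widely_omitting_disjoint_family:
  fixes r :: "'k rel" and T :: "'t set"
  assumes r: "Card_order r" "natLeq <o r" and wo: "widely_omitting r T M"
  obtains h :: "'k \<times> nat \<Rightarrow> 't set" where
    "\<And>i. i \<in> Field r \<times> UNIV \<Longrightarrow> finite (h i) \<and> h i \<noteq> {} \<and> h i \<subseteq> T \<and> omits M (h i)"
    "\<And>i j. i \<in> Field r \<times> UNIV \<Longrightarrow> j \<in> Field r \<times> UNIV \<Longrightarrow> i \<noteq> j \<Longrightarrow> h i \<inter> h j = {}"
proof -
  note inf = Cinfinite_if_uncountable[OF r]
  define P where "P = {E. finite E \<and> E \<noteq> {} \<and> E \<subseteq> T \<and> omits M E}"
  obtain A where A: "A \<subseteq> P" "pairwise disjnt A"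
    and mx: "\<And>p. p \<in> P \<Longrightarrow> (\<And>a. a \<in> A \<Longrightarrow> disjnt a p \<and> disjnt p a) \<Longrightarrow> p \<in> A"
    using maximal_pairwise[of P disjnt] by blast
  have "\<not> |A| <o r"
  proof
    assume "|A| <o r"
    then have "|\<Union>E\<in>A. E| <o r" by (rule UN_finite_ordLess[OF inf]) (use A(1) in \<open>auto simp: P_def\<close>)
    moreover have "(\<Union>E\<in>A. E) \<subseteq> T" using A(1) by (auto simp: P_def)
    ultimately obtain E where E: "finite E" "E \<noteq> {}" "E \<subseteq> T - (\<Union>E\<in>A. E)" "omits M E"
      using wo unfolding widely_omitting_def by meson
    then have "E \<in> P" by (auto simp: P_def)
    then have "E \<in> A" by (rule mx) (use E(3) in \<open>auto simp: disjnt_def\<close>)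
    then show False using E(2,3) by blast
  qed
  then have "r \<le>o |A|"
    using ordLess_or_ordLeq[OF card_of_Well_order card_order_on_well_order_on[OF r(1)]] by blast
  moreover have "|Field r \<times> (UNIV :: nat set)| \<le>o r"
  proof (rule card_of_Times_ordLeq_infinite_Field)
    show "|UNIV :: nat set| \<le>o r"
      by (rule ordIso_ordLeq_trans[OF card_of_nat natLeq_ordLeq_cinfinite[OF inf]])
    show "|Field r| \<le>o r" by (rule ordIso_imp_ordLeq[OF card_of_Field_ordIso[OF r(1)]])
  qed (use inf in \<open>auto simp: cinfinite_def\<close>)
  ultimately have "|Field r \<times> (UNIV :: nat set)| \<le>o |A|" by (rule ordLeq_transitive[rotated])
  then obtain h where h: "inj_on h (Field r \<times> (UNIV :: nat set))" "h ` (Field r \<times> UNIV) \<subseteq> A"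
    using card_of_ordLeq[of "Field r \<times> (UNIV :: nat set)" A] by blast
  show thesis
  proof (rule that)
    fix i assume "i \<in> Field r \<times> (UNIV :: nat set)"
    then have "h i \<in> P" using h(2) A(1) by blast
    then show "finite (h i) \<and> h i \<noteq> {} \<and> h i \<subseteq> T \<and> omits M (h i)" by (simp add: P_def)
  next
    fix i j assume ij: "i \<in> Field r \<times> (UNIV :: nat set)" "j \<in> Field r \<times> (UNIV :: nat set)" "i \<noteq> j"
    then have "h i \<noteq> h j" using h(1) by (auto dest: inj_onD)
    moreover have "h i \<in> A" "h j \<in> A" using h(2) ij by blast+
    ultimately show "h i \<inter> h j = {}" using A(2) by (simp add: pairwise_def disjnt_def)
  qed
qed

text \<open>
  The set \<open>T\<close> is partitioned into blocks \<open>P \<alpha>\<close>, each with infinitely many of the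
  disjoint omitting sets, and \<open>S \<alpha>\<close> consists of the blocks before \<open>\<alpha>\<close>.  The part \<open>Q\<close> of the
  first block, made of its omitting sets with odd index, serves as the countable start; the even ones
  remain for the layer above it.
\<close>

lemma widely_omitting_imp_filtration:
  fixes r :: "'k rel" and T :: "'t set"
  assumes r: "Card_order r" "natLeq <o r" and T: "|T| =o r"
    and M: "closedin (cube T) M" and wo: "widely_omitting r T M"
  obtains S :: "'k \<Rightarrow> 't set" where "fibered_Z_filtration r T M S"
proof -
  note inf = Cinfinite_if_uncountable[OF r]
  have Finf: "infinite (Field r)" using inf by (simp add: cinfinite_def)
  then have Fne: "Field r \<noteq> {}" by auto
  have wo_r: "wo_rel r" using card_order_on_well_order_on[OF r(1)] by (simp add: wo_rel_def)
  let ?I = "Field r \<times> (UNIV :: nat set)"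
  let ?z = "ord_zero r"
  note z = ord_zero_props[OF r(1) Fne]
  note sc = ord_succ_props[OF r(1) Finf]
  obtain h :: "'k \<times> nat \<Rightarrow> 't set" where
    h: "\<And>i. i \<in> ?I \<Longrightarrow> finite (h i) \<and> h i \<noteq> {} \<and> h i \<subseteq> T \<and> omits M (h i)"
    and h_disj: "\<And>i j. i \<in> ?I \<Longrightarrow> j \<in> ?I \<Longrightarrow> i \<noteq> j \<Longrightarrow> h i \<inter> h j = {}"
    using widely_omitting_disjoint_family[OF r wo] by blast
  have "|T| \<le>o |Field r|"
    by (rule ordIso_imp_ordLeq[OF ordIso_transitive[OF T ordIso_symmetric[OF card_of_Field_ordIso[OF r(1)]]]])
  then obtain k where k: "inj_on k T" "k ` T \<subseteq> Field r" using card_of_ordLeq[of T "Field r"] by blast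
  \<comment> \<open>Coordinates in none of the sets \<open>h i\<close> are spread over the blocks by an injection \<open>k\<close>, at most
    one per block, which keeps the blocks countable.\<close>
  define rest where "rest = T - \<Union>(h ` ?I)"
  define P where "P \<alpha> = (\<Union>n. h (\<alpha>, n)) \<union> {t \<in> rest. k t = \<alpha>}" for \<alpha>
  define Q where "Q = (\<Union>n. h (?z, 2 * n + 1))"
  define S where "S \<alpha> = Q \<union> (\<Union>\<beta>\<in>underS r \<alpha>. P \<beta>)" for \<alpha>
  have P_T: "P \<alpha> \<subseteq> T" if "\<alpha> \<in> Field r" for \<alpha> using h that by (auto simp: P_def rest_def)
  have T_P: "\<exists>\<alpha>\<in>Field r. t \<in> P \<alpha>" if "t \<in> T" for t
    using that k(2) by (cases "t \<in> rest") (auto simp: P_def rest_def)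
  have hP: "h (\<alpha>, n) \<inter> P \<beta> = {}" if "\<alpha> \<in> Field r" "\<beta> \<in> Field r" "\<alpha> \<noteq> \<beta>" for \<alpha> \<beta> n
  proof -
    have "h (\<alpha>, n) \<inter> h (\<beta>, m) = {}" for m using that by (intro h_disj) auto
    then show ?thesis using that(1) by (auto simp: P_def rest_def)
  qed
  have Q_P: "Q \<subseteq> P ?z" by (auto simp: Q_def P_def)
  have hS: "h (\<alpha>, 2 * n) \<inter> S \<alpha> = {}" if a: "\<alpha> \<in> Field r" for \<alpha> n
  proof -
    have "h (\<alpha>, 2 * n) \<inter> h (?z, 2 * m + 1) = {}" for m
      using a z(1) by (intro h_disj) (auto, presburger)
    moreover have "h (\<alpha>, 2 * n) \<inter> P \<beta> = {}" if "\<beta> \<in> underS r \<alpha>" for \<beta>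
      using that a by (intro hP) (auto simp: underS_def Field_def)
    ultimately show ?thesis by (auto simp: S_def Q_def)
  qed
  have S_succ: "S (ord_succ r \<alpha>) = S \<alpha> \<union> P \<alpha>" if "\<alpha> \<in> Field r" for \<alpha>
    using sc(4)[OF that] by (auto simp: S_def)
  have S_T: "S \<alpha> \<subseteq> T" for \<alpha>
    using Q_P P_T z(1) by (fastforce simp: S_def underS_def Field_def)
  have S_mono: "S \<alpha> \<subseteq> S \<beta>" if "(\<alpha>, \<beta>) \<in> r" for \<alpha> \<beta>
    using underS_incr[OF wo_rel.TRANS[OF wo_r] wo_rel.ANTISYM[OF wo_r] that] by (auto simp: S_def)
  have P_count: "countable (P \<alpha>)" if a: "\<alpha> \<in> Field r" for \<alpha>
  proof -
    have "finite (h (\<alpha>, n))" for n using h[of "(\<alpha>, n)"] a by simp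
    then have "countable (\<Union>n. h (\<alpha>, n))" by (intro countable_UN) (simp_all add: countable_finite)
    moreover have "inj_on k {t \<in> rest. k t = \<alpha>}"
      using k(1) by (rule inj_on_subset) (auto simp: rest_def)
    then have "finite {t \<in> rest. k t = \<alpha>}"
      by (rule inj_on_finite[of k _ "{\<alpha>}"]) auto
    ultimately show ?thesis by (simp add: P_def countable_finite)
  qed
  have h_inf: "infinite (\<Union>n. h (\<alpha>, f n))" if f: "inj f" and a: "\<alpha> \<in> Field r"
    for \<alpha> and f :: "nat \<Rightarrow> nat"
  proof (rule infinite_UN_disjoint)
    show "h (\<alpha>, f n) \<noteq> {}" for n using h[of "(\<alpha>, f n)"] a by simp
    show "h (\<alpha>, f m) \<inter> h (\<alpha>, f n) = {}" if "m \<noteq> n" for m n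
      using that f a by (intro h_disj) (simp_all add: inj_eq)
  qed
  have "fibered_Z_filtration r T M S"
    unfolding fibered_Z_filtration_def
  proof (intro conjI allI impI ballI)
    show "T = (\<Union>\<alpha>\<in>Field r. S \<alpha>)"
    proof (intro equalityI subsetI)
      fix t assume "t \<in> T"
      then obtain \<alpha> where a: "\<alpha> \<in> Field r" "t \<in> P \<alpha>" using T_P by blast
      then have "t \<in> S (ord_succ r \<alpha>)" by (simp add: S_succ)
      then show "t \<in> (\<Union>\<alpha>\<in>Field r. S \<alpha>)" using sc(1)[OF a(1)] by blast
    qed (use S_T in blast)
    have "S ?z = Q" by (simp add: S_def z(3))
    moreover have "infinite Q" unfolding Q_def by (rule h_inf) (use z(1) in \<open>auto simp: inj_def\<close>)
    moreover have "countable Q" using P_count[OF z(1)] Q_P countable_subset by blast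
    ultimately show "|S ?z| =o natLeq" by (simp add: countable_infinite_natLeq)
  next
    fix \<alpha> assume a: "\<alpha> \<in> Field r"
    have "(\<Union>n. h (\<alpha>, 2 * n)) \<subseteq> P \<alpha> - S \<alpha>" using hS[OF a] by (auto simp: P_def)
    moreover have "infinite (\<Union>n. h (\<alpha>, 2 * n))" by (rule h_inf) (use a in \<open>auto simp: inj_def\<close>)
    ultimately have "infinite (P \<alpha> - S \<alpha>)" by (rule infinite_super)
    moreover have "S (ord_succ r \<alpha>) - S \<alpha> = P \<alpha> - S \<alpha>" using S_succ[OF a] by blast
    ultimately show "|S (ord_succ r \<alpha>) - S \<alpha>| =o natLeq"
      using P_count[OF a] by (simp add: countable_infinite_natLeq)
  next
    fix \<alpha> assume "ord_limit r \<alpha>"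
    then have a: "\<alpha> \<in> Field r" "\<alpha> \<noteq> ?z" "\<And>\<beta>. \<beta> \<in> Field r \<Longrightarrow> \<alpha> \<noteq> ord_succ r \<beta>"
      by (auto simp: ord_limit_def)
    show "S \<alpha> = (\<Union>\<beta>\<in>underS r \<alpha>. S \<beta>)"
    proof (intro equalityI subsetI)
      fix t assume "t \<in> S \<alpha>"
      then consider "t \<in> Q" | \<beta> where "\<beta> \<in> underS r \<alpha>" "t \<in> P \<beta>" by (auto simp: S_def)
      then show "t \<in> (\<Union>\<beta>\<in>underS r \<alpha>. S \<beta>)"
      proof cases
        case 1
        have "?z \<in> underS r \<alpha>" using z(2)[OF a(1)] a(2) by (simp add: underS_def)
        moreover have "t \<in> S ?z" using 1 by (simp add: S_def)
        ultimately show ?thesis by blast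
      next
        case 2
        then have b: "\<beta> \<in> Field r" "(\<beta>, \<alpha>) \<in> r" "\<beta> \<noteq> \<alpha>" by (auto simp: underS_def Field_def)
        have "ord_succ r \<beta> \<in> underS r \<alpha>" using sc(5)[OF b] a(3)[OF b(1)] by (auto simp: underS_def)
        moreover have "t \<in> S (ord_succ r \<beta>)" using 2 b(1) by (simp add: S_succ)
        ultimately show ?thesis by blast
      qed
    next
      fix t assume "t \<in> (\<Union>\<beta>\<in>underS r \<alpha>. S \<beta>)"
      then show "t \<in> S \<alpha>" using S_mono by (auto simp: underS_def)
    qed
  next
    fix \<alpha> assume a: "\<alpha> \<in> Field r"
    let ?W = "S (ord_succ r \<alpha>)"
    show "fibered_Z_set (cube ?W) (\<lambda>x. restrict x (S \<alpha>)) ((\<lambda>x. restrict x ?W) ` M)"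
    proof (rule fibered_Z_setI)
      have "compactin (cube ?W) ((\<lambda>x. restrict x ?W) ` M)"
        by (rule image_compactin[OF closedin_compact_space[OF compact_space_cube M]
              continuous_map_restrict_cube[OF S_T]])
      then show "closedin (cube ?W) ((\<lambda>x. restrict x ?W) ` M)"
        by (rule compactin_imp_closedin[OF Hausdorff_space_cube])
      fix S' assume S': "S' \<subseteq> ?W" "finite S'"
      have "\<exists>n. h (\<alpha>, 2 * n) \<inter> S' = {}"
      proof (rule ccontr)
        assume "\<not> ?thesis"
        then have "|UNIV :: nat set| \<le>o |S'|"
          using h_disj a by (intro card_of_choice_le[of _ "\<lambda>n. h (\<alpha>, 2 * n)"]) auto
        then have "finite (UNIV :: nat set)" using S'(2) card_of_ordLeq_finite by blast
        then show False by simp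
      qed
      then obtain n where n: "h (\<alpha>, 2 * n) \<inter> S' = {}" by blast
      have W: "h (\<alpha>, 2 * n) \<subseteq> ?W" using S_succ[OF a] by (auto simp: P_def)
      then have "h (\<alpha>, 2 * n) \<subseteq> ?W - S' - S \<alpha>" using n hS[OF a] by blast
      moreover have "omits ((\<lambda>x. restrict x ?W) ` M) (h (\<alpha>, 2 * n))"
        using h[of "(\<alpha>, 2 * n)"] a by (intro omits_restrict W) simp
      ultimately show "\<exists>E\<subseteq>?W - S' - S \<alpha>. omits ((\<lambda>x. restrict x ?W) ` M) E" by blast
    qed
  qed (use S_mono in blast)
  then show thesis by (rule that)
qed

section \<open>The equivalence\<close>

theorem proposition3p7:
  fixes \<tau> :: "'k rel" and T :: "'t set" and M :: "('t \<Rightarrow> real) set"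
  assumes "Card_order \<tau>" and "natLeq <o \<tau>" and "|T| =o \<tau>"
    and "closedin (cube T) M"
  shows "(Z_set \<tau> (cube T) M \<longleftrightarrow>
           (\<forall>F. F \<subseteq> M \<and> F \<noteq> {} \<and> closedin (cube T) F \<longrightarrow> pseudocharacter F (cube T) =o \<tau>))
       \<and> ((\<forall>F. F \<subseteq> M \<and> F \<noteq> {} \<and> closedin (cube T) F \<longrightarrow> pseudocharacter F (cube T) =o \<tau>) \<longleftrightarrow>
           (\<exists>S :: 'k \<Rightarrow> 't set.
              (\<forall>\<alpha> \<beta>. (\<alpha>, \<beta>) \<in> \<tau> \<longrightarrow> S \<alpha> \<subseteq> S \<beta>) \<and>
              T = (\<Union>\<alpha>\<in>Field \<tau>. S \<alpha>) \<and>
              |S (ord_zero \<tau>)| =o natLeq \<and>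
              (\<forall>\<alpha>\<in>Field \<tau>. |S (ord_succ \<tau> \<alpha>) - S \<alpha>| =o natLeq) \<and>
              (\<forall>\<alpha>. ord_limit \<tau> \<alpha> \<longrightarrow> S \<alpha> = (\<Union>\<beta>\<in>underS \<tau> \<alpha>. S \<beta>)) \<and>
              (\<forall>\<alpha>\<in>Field \<tau>.
                 fibered_Z_set (cube (S (ord_succ \<tau> \<alpha>))) (\<lambda>x. restrict x (S \<alpha>))
                   ((\<lambda>x. restrict x (S (ord_succ \<tau> \<alpha>))) ` M))))"
proof -
  note inf = Cinfinite_if_uncountable[OF assms(1,2)]
  have wo: "fibre_free \<tau> T M \<Longrightarrow> widely_omitting \<tau> T M"
    by (rule fibre_free_imp_widely_omitting[OF assms(1,2) ordIso_imp_ordLeq[OF ordIso_symmetric[OF assms(3)]] assms(4)])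
  have Z: "Z_set \<tau> (cube T) M \<longleftrightarrow> fibre_free \<tau> T M"
    using Z_set_imp_fibre_free[OF assms(1,2)] widely_omitting_imp_Z_set[OF inf assms(4) wo] by blast
  have filt: "fibre_free \<tau> T M \<longleftrightarrow> (\<exists>S. fibered_Z_filtration \<tau> T M S)"
  proof
    assume "fibre_free \<tau> T M"
    then show "\<exists>S. fibered_Z_filtration \<tau> T M S"
      using widely_omitting_imp_filtration[OF assms wo] by blast
  next
    assume "\<exists>S. fibered_Z_filtration \<tau> T M S"
    then show "fibre_free \<tau> T M"
      using filtration_imp_fibre_free[OF assms(1)] inf by (auto simp: cinfinite_def)
  qed
  show ?thesis
    using Z filt unfolding fibre_free_iff_pseudocharacter[OF assms] fibered_Z_filtration_def
    by (intro conjI)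
qed

end
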